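(* Let $q=3^{2e+1}\ge3$, let $V$ and $\mathrm R(q)\le\mathrm{Sym}(V)$ be as in the context, and let $G=\langle\mathrm R(q),\zeta\rangle$ be a subgroup of $\mathrm{Sym}(V)$ containing $\mathrm R(q)$ as a normal subgroup, where $\zeta$ is an automorphism of $\mathbb F_q$ inducing a permutation of $V$ that fixes $\infty$ and acts componentwise on the elements of $V\setminus\{\infty\}$. Suppose that $P$ is an imprimitive block of $G_\infty$ on $V\setminus\{\infty\}$ containing $\mathbf 0$ such that $|P|=q^2$ and $L_1\cup L_2\subseteq P$, where $L_1=(0,1,0,\ldots)^{\mathrm R(q)_{\infty,\mathbf 0}}$ and $L_2=(0,\delta,0,\ldots)^{\mathrm R(q)_{\infty,\mathbf 0}}$ with $\delta$ a generator of $\mathbb F_q^\times$. Then: (a) $P=\{(0,\eta_2,\eta_3,\ldots):\eta_2,\eta_3\in\mathbb F_q\}$ and $G_{\infty,P}=\langle n_\kappa,t_{0,\xi,\eta},\zeta:\xi,\eta\in\mathbb F_q,\kappa\in\mathbb F_q^\times\rangle$; (b) setting $L:=P\cup\{\infty\}$, $\mathcal D:=(V,L^{\mathrm R(q)})=(V,L^G)$ is a $2$-$(q^3+1,q^2+1,q^2+1)$ design admitting $G$ as a $2$-point-transitive and block-transitive group of automorphisms, and $\Omega:=(\infty,L)^{\mathrm R(q)}=(\infty,L)^G$ is a 1-feasible $G$-orbit on the flag set of $\mathcal D$; moreover, the $G$-flag graph of $\mathcal D$ with respect to $(\Omega,\Xi)$ is the same as the $\mathrm R(q)$-flag graph $\Gamma(\mathcal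 D,\Omega,\Xi)$ with respect to $(\Omega,\Xi)$; (c) $\Gamma(\mathcal D,\Omega,\Xi)$ is connected with order $|\Omega|=q(q^3+1)$ and valency $q^2$.
   Context: Groups act on the right. $G_x$ is a point stabilizer, $G_{x,P}$ the setwise stabilizer of $P$ in $G_x$. For a transitive group $X$ on $\Delta$, an imprimitive block is a nonempty $P\subseteq\Delta$ with $P^g=P$ or $P^g\cap P=\emptyset$ for all $g\in X$. Ree group: $\sigma:\xi\mapsto\xi^{3^{e+1}}$ is an automorphism of $\mathbb F_q$. $V$ consists of $\infty$ and all $(\eta_1,\eta_2,\eta_3,\lambda_1,\lambda_2,\lambda_3)$ with $\eta_i\in\mathbb F_q$ and $\lambda_1=\eta_1^2\eta_2-\eta_1\eta_3+\eta_2^\sigma-\eta_1^{\sigma+3}$, $\lambda_2=\eta_1^\sigma\eta_2^\sigma-\eta_3^\sigma+\eta_1\eta_2^2+\eta_2\eta_3-\eta_1^{2\sigma+3}$, $\lambda_3=\eta_1\eta_3^\sigma-\eta_1^{\sigma+1}\eta_2^\sigma+\eta_1^{\sigma+3}\eta_2+\eta_1^2\eta_2^2-\eta_2^{\sigma+1}-\eta_3^2+\eta_1^{2\sigma+4}$; such a point is written $(\eta_1,\eta_2,\eta_3,\ldots)$, and $\mathbf 0=(0,0,0,0,0,0)$. For $\alpha,\beta,\gamma,\kappa\in\mathbb F_q$, $\kappa\ne0$, the permutations $t_{\alpha,\beta,\gamma}$ and $n_\kappa$ fix $\infty$ and satisfy $t_{\alpha,\beta,\gamma}:(\eta_1,\eta_2,\eta_3,\ldots)\mapsto(\eta_1+\alpha,\eta_2+\beta+\alpha^\sigma\eta_1,\eta_3+\gamma-\alpha\eta_2+\beta\eta_1-\alpha^{\sigma+1}\eta_1,\ldots)$,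 $n_\kappa:(\eta_1,\eta_2,\eta_3,\ldots)\mapsto(\kappa\eta_1,\kappa^{\sigma+1}\eta_2,\kappa^{\sigma+2}\eta_3,\ldots)$. The involution $w$ is $(\eta_1,\eta_2,\eta_3,\lambda_1,\lambda_2,\lambda_3)\leftrightarrow(\lambda_2/\lambda_3,\lambda_1/\lambda_3,\eta_3/\lambda_3,\eta_2/\lambda_3,\eta_1/\lambda_3,1/\lambda_3)$ for $\lambda_3\neq0$, $\infty\leftrightarrow\mathbf 0$. $\mathrm R(q)$ is generated by $w$ and all $t_{\alpha,\beta,\gamma}$, $n_\kappa$; $\mathrm R(q)_{\infty,\mathbf 0}=\{n_\kappa:\kappa\in\mathbb F_q^\times\}$. Designs and flag graphs: $(V,L^G)$ is the incidence structure with point set $V$, block set $\{L^g:g\in G\}$ and incidence given by inclusion. A flag is a pair $(x,L)$ with $L$ a block, $x\in L$. For a $G$-orbit $\Omega$ on flags, $\Omega(x)$ is the set of flags in $\Omega$ with point entry $x$; $\Omega$ is 1-feasible if (i) $|\Omega(x)|\ge2$; (ii) for some (hence all) $(x,L)\in\Omega$, $G_{x,L}$ is transitive on $L\setminus\{x\}$; (iii) $L\cap N=\{x\}$ for distinct $(x,L),(x,N)\in\Omega(x)$. $\Xi=\Xi(\mathcal D,\Omega)$ is the set of $((x,L),(y,N))\in\Omega\times\Omega$ with $x\ne y$ and $x,y\in L\cap N$ (a self-paired $G$-orbit when $\Omega$ is 1-feasible and $G$ is 2-transitive on points). The $G$-flag graph $\Gamma(\mathcal D,\Omega,\Xi)$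 has vertex set $\Omega$ and arc set $\Xi$. *)

theory Defs
  imports
    "HOL-Algebra.Group_Action"
    "HOL-Algebra.Generated_Groups"
    "HOL-Computational_Algebra.Primes"
    "HOL-Library.Cardinality"
    "Graph_Theory.Digraph_Component"
begin

section \<open>Permutation groups\<close>

text \<open>
  A permutation group on \<open>V\<close> is a group record whose elements are functions in
  \<open>Bij V\<close>, with the multiplication of \<open>BijGroup V\<close>, which serves as Sym(V). The image
  \<open>x\<^sup>g\<close> of a point is written \<open>g x\<close> and the image of a set is \<open>g ` A\<close>. With the right
  actions of the source the product of two permutations is formed in the opposite order; subgroups,
  generated subgroups, normality, orbits and stabilizers are the same in both conventions.
\<close>

definition stab_group :: "('g, 'm) monoid_scheme \<Rightarrow> ('g \<Rightarrow> 'x \<Rightarrow> 'x) \<Rightarrow> 'x \<Rightarrow> ('g, 'm) monoid_scheme"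
  where "stab_group G \<phi> x = G\<lparr>carrier := stabilizer G \<phi> x\<rparr>"

definition transitive_on :: "('g, 'm) monoid_scheme \<Rightarrow> ('g \<Rightarrow> 'x \<Rightarrow> 'x) \<Rightarrow> 'x set \<Rightarrow> bool"
  where "transitive_on G \<phi> X \<longleftrightarrow> (\<forall>x\<in>X. \<forall>y\<in>X. \<exists>g\<in>carrier G. \<phi> g x = y)"

definition two_transitive_on :: "('v \<Rightarrow> 'v, 'm) monoid_scheme \<Rightarrow> 'v set \<Rightarrow> bool"
  where "two_transitive_on G V \<longleftrightarrow>
    transitive_on G (\<lambda>g. map_prod g g) {(x, y). x \<in> V \<and> y \<in> V \<and> x \<noteq> y}"

text \<open>Meant for \<open>G\<close> transitive on \<open>X\<close>; all of \<open>X\<close> and singletons count as blocks.\<close>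

definition imprimitive_block :: "('v \<Rightarrow> 'v, 'm) monoid_scheme \<Rightarrow> 'v set \<Rightarrow> 'v set \<Rightarrow> bool"
  where "imprimitive_block G X P \<longleftrightarrow>
    P \<noteq> {} \<and> P \<subseteq> X \<and> (\<forall>g\<in>carrier G. g ` P = P \<or> g ` P \<inter> P = {})"


section \<open>Designs\<close>

text \<open>An incidence structure whose blocks are sets of points, with incidence given by membership.\<close>

type_synonym 'v incidence_structure = "'v set \<times> 'v set set"

definition is_design :: "nat \<Rightarrow> nat \<Rightarrow> nat \<Rightarrow> nat \<Rightarrow> 'v incidence_structure \<Rightarrow> bool"
  where "is_design t v k l D \<longleftrightarrow> (case D of (V, B) \<Rightarrow>
    finite V \<and> card V = v \<and>
    (\<forall>L\<in>B. L \<subseteq> V \<and> card L = k) \<and>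
    (\<forall>T. T \<subseteq> V \<and> card T = t \<longrightarrow> card {L \<in> B. T \<subseteq> L} = l))"

definition automorphisms :: "'v incidence_structure \<Rightarrow> ('v \<Rightarrow> 'v) set"
  where "automorphisms D = (case D of (V, B) \<Rightarrow> {g \<in> Bij V. image g ` B = B})"

definition automorphism_group :: "('v \<Rightarrow> 'v, 'm) monoid_scheme \<Rightarrow> 'v incidence_structure \<Rightarrow> bool"
  where "automorphism_group G D \<longleftrightarrow>
    subgroup (carrier G) (BijGroup (fst D)) \<and> carrier G \<subseteq> automorphisms D"


section \<open>Flags and flag graphs\<close>

type_synonym 'v flag = "'v \<times> 'v set"

definition flags :: "'v incidence_structure \<Rightarrow> 'v flag set"
  where "flags D = {(x, L). x \<in> fst D \<and> L \<in> snd D \<and> x \<in> L}"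

definition flag_act :: "('v \<Rightarrow> 'v) \<Rightarrow> 'v flag \<Rightarrow> 'v flag"
  where "flag_act g = map_prod g (image g)"

definition flags_at :: "'v flag set \<Rightarrow> 'v \<Rightarrow> 'v flag set"
  where "flags_at \<Omega> x = {F \<in> \<Omega>. fst F = x}"

definition flag_orbit :: "('v \<Rightarrow> 'v, 'm) monoid_scheme \<Rightarrow> 'v incidence_structure \<Rightarrow> 'v flag set \<Rightarrow> bool"
  where "flag_orbit G D \<Omega> \<longleftrightarrow> (\<exists>F\<in>flags D. \<Omega> = Group_Action.orbit G flag_act F)"

text \<open>
  In (ii) "for some flag" and "for all flags" agree because \<open>\<Omega>\<close> is an orbit (in particular
  nonempty); (i) and (iii) are imposed at every point.
\<close>

definition one_feasible :: "('v \<Rightarrow> 'v, 'm) monoid_scheme \<Rightarrow> 'v incidence_structure \<Rightarrow> 'v flag set \<Rightarrow> bool"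
  where "one_feasible G D \<Omega> \<longleftrightarrow>
    flag_orbit G D \<Omega> \<and>
    (\<forall>x\<in>fst D. card (flags_at \<Omega> x) \<ge> 2) \<and>
    (\<forall>(x, L)\<in>\<Omega>.
       transitive_on (stab_group (stab_group G (\<lambda>g. g) x) image L) (\<lambda>g. g) (L - {x})) \<and>
    (\<forall>x\<in>fst D. \<forall>L N. (x, L) \<in> flags_at \<Omega> x \<and> (x, N) \<in> flags_at \<Omega> x \<and> L \<noteq> N
       \<longrightarrow> L \<inter> N = {x})"

definition flag_pairs :: "'v flag set \<Rightarrow> ('v flag \<times> 'v flag) set"
  where "flag_pairs \<Omega> = {((x, L), (y, N)) | x L y N.
    (x, L) \<in> \<Omega> \<and> (y, N) \<in> \<Omega> \<and> x \<noteq> y \<and> x \<in> L \<inter> N \<and> y \<in> L \<inter> N}"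

definition self_paired_orbit ::
    "('v \<Rightarrow> 'v, 'm) monoid_scheme \<Rightarrow> 'v flag set \<Rightarrow> ('v flag \<times> 'v flag) set \<Rightarrow> bool"
  where "self_paired_orbit G \<Omega> \<Xi> \<longleftrightarrow>
    (\<exists>A \<in> \<Omega> \<times> \<Omega>. \<Xi> = Group_Action.orbit G (\<lambda>g. map_prod (flag_act g) (flag_act g)) A) \<and> \<Xi>\<inverse> = \<Xi>"

definition flag_graph :: "'v flag set \<Rightarrow> ('v flag \<times> 'v flag) set \<Rightarrow> 'v flag pair_pre_digraph"
  where "flag_graph \<Omega> \<Xi> = \<lparr>pverts = \<Omega>, parcs = \<Xi>\<rparr>"

text \<open>
  The vertices and arcs of a \<open>G\<close>-flag graph do not mention \<open>G\<close>; the dependence on \<open>G\<close> lies in the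
  requirements on \<open>\<Omega>\<close> and \<open>\<Xi>\<close>.
\<close>

definition is_flag_graph ::
    "('v \<Rightarrow> 'v, 'm) monoid_scheme \<Rightarrow> 'v incidence_structure \<Rightarrow> 'v flag set \<Rightarrow>
     ('v flag \<times> 'v flag) set \<Rightarrow> 'v flag pair_pre_digraph \<Rightarrow> bool"
  where "is_flag_graph G D \<Omega> \<Xi> \<Gamma> \<longleftrightarrow>
    one_feasible G D \<Omega> \<and> \<Xi> = flag_pairs \<Omega> \<and> self_paired_orbit G \<Omega> \<Xi> \<and> \<Gamma> = flag_graph \<Omega> \<Xi>"


section \<open>The Ree group\<close>

text \<open>
  The field with \<open>3 ^ (2 * e + 1)\<close> elements is the universe of a type \<open>'a\<close>; every definition is
  meant for that cardinality. The automorphism \<open>\<sigma>\<close> is the power map with exponent \<open>\<sigma> e\<close>, so that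
  an exponent such as \<open>2 * \<sigma> + 3\<close> is a natural number.
\<close>

datatype 'a ree_point = Infty | Aff 'a 'a 'a 'a 'a 'a

definition \<sigma> :: "nat \<Rightarrow> nat"
  where "\<sigma> e = 3 ^ (e + 1)"

definition lam1 :: "nat \<Rightarrow> 'a \<Rightarrow> 'a \<Rightarrow> 'a \<Rightarrow> 'a::finite_field"
  where "lam1 e a b c = a^2 * b - a * c + b^\<sigma> e - a^(\<sigma> e + 3)"

definition lam2 :: "nat \<Rightarrow> 'a \<Rightarrow> 'a \<Rightarrow> 'a \<Rightarrow> 'a::finite_field"
  where "lam2 e a b c =
    a^\<sigma> e * b^\<sigma> e - c^\<sigma> e + a * b^2 + b * c - a^(2 * \<sigma> e + 3)"

definition lam3 :: "nat \<Rightarrow> 'a \<Rightarrow> 'a \<Rightarrow> 'a \<Rightarrow> 'a::finite_field"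
  where "lam3 e a b c =
    a * c^\<sigma> e - a^(\<sigma> e + 1) * b^\<sigma> e + a^(\<sigma> e + 3) * b + a^2 * b^2
      - b^(\<sigma> e + 1) - c^2 + a^(2 * \<sigma> e + 4)"

definition ree_pt :: "nat \<Rightarrow> 'a \<Rightarrow> 'a \<Rightarrow> 'a \<Rightarrow> 'a::finite_field ree_point"
  where "ree_pt e a b c = Aff a b c (lam1 e a b c) (lam2 e a b c) (lam3 e a b c)"

definition origin :: "'a::finite_field ree_point"
  where "origin = Aff 0 0 0 0 0 0"

definition ree_points :: "nat \<Rightarrow> 'a::finite_field ree_point set"
  where "ree_points e = insert Infty {ree_pt e a b c | a b c. True}"

definition ree_t :: "nat \<Rightarrow> 'a \<Rightarrow> 'a \<Rightarrow> 'a \<Rightarrow> 'a ree_point \<Rightarrow> 'a::finite_field ree_point"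
  where "ree_t e \<alpha> \<beta> \<gamma> = (\<lambda>x\<in>ree_points e. case x of
      Infty \<Rightarrow> Infty
    | Aff a b c _ _ _ \<Rightarrow>
        ree_pt e (a + \<alpha>) (b + \<beta> + \<alpha>^\<sigma> e * a) (c + \<gamma> - \<alpha> * b + \<beta> * a - \<alpha>^(\<sigma> e + 1) * a))"

definition ree_n :: "nat \<Rightarrow> 'a \<Rightarrow> 'a ree_point \<Rightarrow> 'a::finite_field ree_point"
  where "ree_n e \<kappa> = (\<lambda>x\<in>ree_points e. case x of
      Infty \<Rightarrow> Infty
    | Aff a b c _ _ _ \<Rightarrow> ree_pt e (\<kappa> * a) (\<kappa>^(\<sigma> e + 1) * b) (\<kappa>^(\<sigma> e + 2) * c))"

text \<open>On \<open>ree_points e\<close> the origin is the only affine point whose last coordinate is \<open>0\<close>.\<close>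

definition ree_w :: "nat \<Rightarrow> 'a ree_point \<Rightarrow> 'a::finite_field ree_point"
  where "ree_w e = (\<lambda>x\<in>ree_points e. case x of
      Infty \<Rightarrow> origin
    | Aff a b c l1 l2 l3 \<Rightarrow>
        if x = origin then Infty
        else Aff (l2 / l3) (l1 / l3) (c / l3) (b / l3) (a / l3) (1 / l3))"

text \<open>
  \<open>subgroup_generated\<close> discards generators outside the ambient carrier; for a field of the intended
  cardinality all the generators below are elements of \<open>Bij (ree_points e)\<close>.
\<close>

definition ree_group :: "nat \<Rightarrow> ('a::finite_field ree_point \<Rightarrow> 'a ree_point) monoid"
  where "ree_group e = subgroup_generated (BijGroup (ree_points e))
    ({ree_w e} \<union> {ree_t e \<alpha> \<beta> \<gamma> | \<alpha> \<beta> \<gamma>. True} \<union> {ree_n e \<kappa> | \<kappa>. \<kappa> \<noteq> 0})"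

definition field_automorphism :: "('a::field \<Rightarrow> 'a) \<Rightarrow> bool"
  where "field_automorphism f \<longleftrightarrow>
    bij f \<and> f 1 = 1 \<and> (\<forall>x y. f (x + y) = f x + f y) \<and> (\<forall>x y. f (x * y) = f x * f y)"

definition field_perm :: "nat \<Rightarrow> ('a \<Rightarrow> 'a) \<Rightarrow> 'a ree_point \<Rightarrow> 'a::finite_field ree_point"
  where "field_perm e f = (\<lambda>x\<in>ree_points e. case x of
      Infty \<Rightarrow> Infty
    | Aff a b c l1 l2 l3 \<Rightarrow> Aff (f a) (f b) (f c) (f l1) (f l2) (f l3))"

definition generates_units :: "'a::field \<Rightarrow> bool"
  where "generates_units \<delta> \<longleftrightarrow> \<delta> \<noteq> 0 \<and> range (\<lambda>k::int. \<delta> powi k) = - {0}"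

end

theory Submission
  imports Defs "HOL-Number_Theory.Residues" "HOL-Algebra.Zassenhaus"
begin

text \<open>
  Write \<open>pt a b c\<close> for the affine point with first coordinates \<open>a\<close>,
  \<open>b\<close>, \<open>c\<close> and \<open>s x\<close> for the power of \<open>x\<close> with
  exponent \<open>\<sigma> e\<close>. The characteristic is \<open>3\<close> and
  \<open>s (s x) = x ^ 3\<close>. The point \<open>pt a b c\<close> is best thought of as the
  vector \<open>(1, a, b, c, \<lambda>\<^sub>1, \<lambda>\<^sub>2, \<lambda>\<^sub>3)\<close> up
  to scalars, with \<open>Infty\<close> as \<open>(0, 0, 0, 0, 0, 0, 1)\<close>: every generator
  of the Ree group is then a linear map, and \<open>w\<close> reverses the order of the
  coordinates.

  The definitions leave two facts about the Ree group to be proved. The first is that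
  \<open>w\<close> is a permutation of the point set. The powers \<open>s b\<close>,
  \<open>s c\<close>, \<open>s \<lambda>\<^sub>1\<close>, \<open>s \<lambda>\<^sub>2\<close>,
  \<open>s \<lambda>\<^sub>3\<close> are linear in \<open>s a\<close> over the polynomials in
  \<open>a\<close>, \<open>b\<close>, \<open>c\<close>, \<open>\<lambda>\<^sub>1\<close>,
  \<open>\<lambda>\<^sub>2\<close>; this turns the equations for the image point into polynomial
  identities modulo \<open>3\<close> (\<open>reversed_lam1\<close>, \<open>reversed_lam2\<close>).
  Identities of the same kind show that \<open>\<lambda>\<^sub>3\<close> vanishes only at the
  origin (\<open>lam3_eq_0_iff\<close>). As the \<open>t\<close> are transitive on affine points,
  the Ree group is \<open>2\<close>-transitive. The second fact is that only the \<open>n\<close>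
  fix both \<open>Infty\<close> and the origin (\<open>stabilizer_two_points\<close>). It holds
  because the group preserves, up to a scalar for each point, a symmetric bilinear form and an
  alternating trilinear form, and the values of the two forms on points recover enough coordinates
  to force the shape of the permutation.

  For (a): the two orbits make \<open>P\<close> contain all \<open>pt 0 b 0\<close>, because the
  numbers \<open>\<kappa> ^ (\<sigma> e + 1)\<close> are the nonzero squares. A point
  \<open>pt \<alpha> b c\<close> of \<open>P\<close> with \<open>\<alpha> \<noteq> 0\<close>
  would, by commutators in the group of the \<open>t\<close>, bring all
  \<open>pt \<alpha> b' c'\<close> into \<open>P\<close>; with the origin these are more than
  \<open>q\<^sup>2\<close> points (\<open>P_eq\<close>). The group \<open>G\<close> is the product
  of the Ree group and the powers of \<open>\<zeta>\<close>, so the stabilizer of \<open>P\<close>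
  follows from the second fact.

  For (b) and the numbers in (c) only \<open>2\<close>-transitivity and the block property of
  \<open>P\<close> matter, and the locale \<open>flag_setting\<close> argues from these alone. The
  flags at a point \<open>x\<close> partition the other points into \<open>q\<close> sets of size
  \<open>q\<^sup>2\<close>; so there are \<open>q (q\<^sup>3 + 1)\<close> flags, and a block
  carries just one of them, since otherwise it would carry \<open>q\<^sup>2 + 1\<close>, a number
  that does not divide \<open>q (q\<^sup>3 + 1)\<close> (\<open>nucleus_unique\<close>). This
  gives the number of blocks, hence the design.

  Connectedness needs one explicit computation. Two paths lead from \<open>(Infty, L)\<close> to
  flags at \<open>pt 0 1 1\<close>, an arc and a path of length two through a flag at the origin,
  and they end in different flags. As the stabilizer of \<open>(Infty, L)\<close> permutes the
  other flags at \<open>Infty\<close> transitively, every component contains all flags at each of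
  its points, and any two points lie on the flags of some arc
  (\<open>connected_flag_graph\<close>).
\<close>

section \<open>Permutation groups\<close>

locale permutation_group =
  fixes V :: "'v set" and G :: "('v \<Rightarrow> 'v, 'm) monoid_scheme"
  assumes subgroup: "subgroup (carrier G) (BijGroup V)"
begin

lemma Bij: "g \<in> carrier G \<Longrightarrow> g \<in> Bij V"
  using subgroup.subset[OF subgroup] by (auto simp: BijGroup_def)

lemma bij_betw: "g \<in> carrier G \<Longrightarrow> bij_betw g V V"
  using Bij by (auto simp: Bij_def)

lemma closed: "g \<in> carrier G \<Longrightarrow> x \<in> V \<Longrightarrow> g x \<in> V"
  using bij_betw by (auto simp: bij_betw_def)

lemma inj_on: "g \<in> carrier G \<Longrightarrow> inj_on g V"
  using bij_betw by (auto simp: bij_betw_def)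

lemma eq_iff: "g \<in> carrier G \<Longrightarrow> x \<in> V \<Longrightarrow> y \<in> V \<Longrightarrow> g x = g y \<longleftrightarrow> x = y"
  using inj_on by (auto simp: inj_on_def)

lemma image_closed: "g \<in> carrier G \<Longrightarrow> A \<subseteq> V \<Longrightarrow> g ` A \<subseteq> V"
  using closed by auto

lemma card_image: "g \<in> carrier G \<Longrightarrow> A \<subseteq> V \<Longrightarrow> card (g ` A) = card A"
  using inj_on by (meson card_image inj_on_subset)

lemma compose: "g \<in> carrier G \<Longrightarrow> h \<in> carrier G \<Longrightarrow> compose V g h \<in> carrier G"
  using subgroup.m_closed[OF subgroup, of g h] Bij[of g] Bij[of h] by (simp add: BijGroup_def)

lemma identity: "(\<lambda>x\<in>V. x) \<in> carrier G"
  using subgroup.one_closed[OF subgroup] by (simp add: BijGroup_def)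

lemma inverse:
  assumes "g \<in> carrier G"
  shows "\<exists>h\<in>carrier G. (\<forall>x\<in>V. h (g x) = x) \<and> (\<forall>x\<in>V. g (h x) = x)"
proof (intro bexI conjI ballI)
  show "restrict (inv_into V g) V \<in> carrier G"
    using subgroup.m_inv_closed[OF subgroup assms] Bij[OF assms] by (simp add: inv_BijGroup)
  show "restrict (inv_into V g) V (g x) = x" if "x \<in> V" for x
    using that closed[OF assms that] inj_on[OF assms] by simp
  show "g (restrict (inv_into V g) V x) = x" if "x \<in> V" for x
    using that bij_betw[OF assms] by (simp add: bij_betw_def f_inv_into_f)
qed

lemma compose_image: "A \<subseteq> V \<Longrightarrow> compose V g h ` A = g ` h ` A"
  by (auto simp: compose_def image_image)

lemma identity_image: "A \<subseteq> V \<Longrightarrow> (\<lambda>x\<in>V. x) ` A = A"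
  by auto

lemma inverse_image:
  assumes "\<forall>x\<in>V. h (g x) = x" "A \<subseteq> V"
  shows "h ` g ` A = A"
  using assms by (force simp: image_image)

lemma subgroup_stabilizer:
  assumes "x \<in> V" "A \<subseteq> V"
  shows "subgroup {g \<in> carrier G. g x = x \<and> g ` A = A} (BijGroup V)"
proof
  show "{g \<in> carrier G. g x = x \<and> g ` A = A} \<subseteq> carrier (BijGroup V)"
    using Bij by (auto simp: BijGroup_def)
  show "g \<otimes>\<^bsub>BijGroup V\<^esub> h \<in> {g \<in> carrier G. g x = x \<and> g ` A = A}"
    if gh: "g \<in> {g \<in> carrier G. g x = x \<and> g ` A = A}" "h \<in> {g \<in> carrier G. g x = x \<and> g ` A = A}" for g h
  proof -
    have "g \<otimes>\<^bsub>BijGroup V\<^esub> h = compose V g h"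
      using gh Bij by (simp add: BijGroup_def)
    then show ?thesis
      using gh compose[of g h] assms by (simp add: compose_eq compose_image)
  qed
  show "\<one>\<^bsub>BijGroup V\<^esub> \<in> {g \<in> carrier G. g x = x \<and> g ` A = A}"
    using identity assms identity_image[OF assms(2)] by (simp add: BijGroup_def)
  show "inv\<^bsub>BijGroup V\<^esub> g \<in> {g \<in> carrier G. g x = x \<and> g ` A = A}"
    if g: "g \<in> {g \<in> carrier G. g x = x \<and> g ` A = A}" for g
  proof -
    define h where "h = restrict (inv_into V g) V"
    have "inv\<^bsub>BijGroup V\<^esub> g = h"
      using g Bij by (simp add: inv_BijGroup h_def)
    moreover have h: "inv\<^bsub>BijGroup V\<^esub> g \<in> carrier G"
      using subgroup.m_inv_closed[OF subgroup] g by simp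
    moreover have hg: "\<forall>x\<in>V. h (g x) = x"
      using g inj_on[of g] closed[of g] by (simp add: h_def)
    moreover have "h x = x" using hg assms(1) g by force
    moreover have "h ` A = A" using inverse_image[of h g, OF hg assms(2)] g by simp
    ultimately show ?thesis by simp
  qed
qed

end

section \<open>Flags of a two-transitive group with a block of a point stabilizer\<close>

lemma card_offdiagonal:
  assumes "finite A"
  shows "card {(x, y). x \<in> A \<and> y \<in> A \<and> x \<noteq> y} = card A * (card A - 1)"
proof -
  have "{(x, y). x \<in> A \<and> y \<in> A \<and> x \<noteq> y} = (SIGMA x:A. A - {x})"
    by auto
  then show ?thesis
    using assms by simp
qed

text \<open>
  In the application \<open>z\<close> is \<open>Infty\<close>. The locale is used for the Ree
  group and for its extension \<open>G\<close>, with the same blocks and flags.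
\<close>

locale flag_setting = permutation_group V G
  for V :: "'v set" and G :: "('v \<Rightarrow> 'v, 'm) monoid_scheme" +
  fixes z :: 'v and P L :: "'v set" and q :: nat and B :: "'v set set" and \<Omega> :: "'v flag set"
  assumes finite_V: "finite V" and card_V: "card V = q ^ 3 + 1" and q: "q \<ge> 2"
    and z: "z \<in> V" and P: "P \<subseteq> V - {z}" and card_P: "card P = q\<^sup>2"
    and two_transitive: "\<And>x y x' y'. \<lbrakk>x \<in> V; y \<in> V; x \<noteq> y; x' \<in> V; y' \<in> V; x' \<noteq> y'\<rbrakk> \<Longrightarrow>
      \<exists>g\<in>carrier G. g x = x' \<and> g y = y'"
    and block: "\<And>g. g \<in> carrier G \<Longrightarrow> g z = z \<Longrightarrow> g ` P = P \<or> g ` P \<inter> P = {}"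
    and L: "L = insert z P"
    and B: "B = Group_Action.orbit G image L"
    and \<Omega>: "\<Omega> = Group_Action.orbit G flag_act (z, L)"
begin

lemma L_subset: "L \<subseteq> V"
  using L P z by auto

lemma card_L: "card L = q\<^sup>2 + 1"
proof -
  have "finite P" "z \<notin> P"
    using P finite_V finite_subset by auto
  then show ?thesis
    using L card_P by simp
qed

lemma flagE:
  assumes "(x, M) \<in> \<Omega>"
  obtains g where "g \<in> carrier G" "g z = x" "g ` L = M"
  using assms by (auto simp: \<Omega> Group_Action.orbit_def flag_act_def)

lemma flagI: "g \<in> carrier G \<Longrightarrow> (g z, g ` L) \<in> \<Omega>"
  by (auto simp: \<Omega> Group_Action.orbit_def flag_act_def)

lemma flag_act: 
  assumes "g \<in> carrier G" "(x, M) \<in> \<Omega>"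
  shows "(g x, g ` M) \<in> \<Omega>"
proof -
  obtain h where h: "h \<in> carrier G" "h z = x" "h ` L = M"
    by (rule flagE[OF assms(2)])
  show ?thesis
    using flagI[OF compose[OF assms(1) h(1)]] h L_subset z by (simp add: compose_image compose_eq)
qed

lemma base_flag: "(z, L) \<in> \<Omega>"
  using flagI[OF identity] z unfolding identity_image[OF L_subset] by simp

lemma flag_props:
  assumes "(x, M) \<in> \<Omega>"
  shows "x \<in> V" "x \<in> M" "M \<subseteq> V" "card M = q\<^sup>2 + 1" "M \<in> B"
proof -
  obtain h where h: "h \<in> carrier G" "h z = x" "h ` L = M"
    using assms by (rule flagE)
  show "x \<in> V"
    using closed[OF h(1) z] h by simp
  show "x \<in> M"
    using h L by auto
  show "M \<subseteq> V"
    using image_closed[OF h(1) L_subset] h by simp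
  show "card M = q\<^sup>2 + 1"
    using card_image[OF h(1) L_subset] h card_L by simp
  show "M \<in> B"
    using h by (auto simp: B Group_Action.orbit_def)
qed

lemma block_flag: 
  assumes "M \<in> B"
  obtains x where "(x, M) \<in> \<Omega>"
  using assms flagI by (auto simp: B Group_Action.orbit_def)

text \<open>
  Condition (iii) of feasibility. Moving \<open>(x, M)\<close> to \<open>(z, L)\<close> turns
  \<open>N - {x}\<close> into an image of \<open>P\<close> under the stabilizer of
  \<open>z\<close> that meets \<open>P\<close>, so the block property applies.
\<close>

lemma flags_disjoint:
  assumes "(x, M) \<in> \<Omega>" "(x, N) \<in> \<Omega>" "y \<in> M" "y \<in> N" "y \<noteq> x"
  shows "M = N"
proof -
  obtain g where g: "g \<in> carrier G" "g z = x" "g ` L = M"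
    by (rule flagE[OF assms(1)])
  obtain g' where g': "g' \<in> carrier G" "\<forall>x\<in>V. g' (g x) = x" "\<forall>x\<in>V. g (g' x) = x"
    using inverse[OF g(1)] by blast
  have "(g' x, g' ` N) \<in> \<Omega>"
    using flag_act assms g' by blast
  then obtain h where h: "h \<in> carrier G" "h z = g' x" "h ` L = g' ` N"
    by (rule flagE)
  have hz: "h z = z"
    using h g g' z by auto
  have y: "y \<in> V" using assms flag_props by blast
  have "g' y \<in> L"
    using assms(3) g g'(2) L_subset by auto
  moreover have "g' y \<in> h ` L"
    using assms(4) h by auto
  moreover have "g' y \<noteq> z"
    using assms(5) g g'(3) y by metis
  ultimately have "g' y \<in> h ` P \<inter> P"
    using L hz by auto
  then have "h ` P = P"
    using block[OF h(1) hz] by auto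
  then have "h ` L = L"
    using L hz by auto
  then have "g ` g' ` N = M"
    using h g by simp
  then show ?thesis
    using inverse_image[of g g' N] g'(3) flag_props(3)[OF assms(2)] by simp
qed

lemma flag_through:
  assumes "x \<in> V" "y \<in> V" "x \<noteq> y"
  obtains M where "(x, M) \<in> \<Omega>" "y \<in> M"
proof -
  have "P \<noteq> {}" using card_P q by auto
  then obtain p where p: "p \<in> P" by auto
  then obtain g where "g \<in> carrier G" "g z = x" "g p = y"
    using two_transitive[of z p x y] assms P z by auto
  then show thesis
    using that[of "g ` L"] flagI p L by auto
qed

text \<open>
  Condition (ii) of feasibility: an element that fixes \<open>x\<close> and takes \<open>y\<close>
  to \<open>y'\<close> exists by \<open>2\<close>-transitivity, and it cannot move
  \<open>M\<close> because \<open>y'\<close> lies on a single flag at \<open>x\<close>.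
\<close>

lemma flag_stabilizer_transitive:
  assumes "(x, M) \<in> \<Omega>" "y \<in> M - {x}" "y' \<in> M - {x}"
  obtains g where "g \<in> carrier G" "g x = x" "g ` M = M" "g y = y'"
proof -
  obtain g where g: "g \<in> carrier G" "g x = x" "g y = y'"
    using two_transitive[of x y x y'] assms flag_props(1,3)[OF assms(1)] by auto
  have "g ` M = M"
    using flags_disjoint[of x "g ` M" M y'] flag_act[OF g(1) assms(1)] assms g by auto
  then show thesis using that g by blast
qed

lemma finite_Omega: "finite \<Omega>"
proof (rule finite_subset)
  show "\<Omega> \<subseteq> V \<times> Pow V"
    using flag_props(1,3) by (metis (no_types, lifting) PowI SigmaI subrelI)
qed (use finite_V in simp)

lemma finite_B: "finite B"
proof (rule finite_subset)
  show "B \<subseteq> Pow V"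
    using block_flag flag_props(3) by (metis PowI subsetI)
qed (use finite_V in simp)

lemma finite_block: "(x, M) \<in> \<Omega> \<Longrightarrow> finite M"
  using flag_props(3) finite_V by (rule finite_subset)

text \<open>
  The sets \<open>M - {x}\<close> for the flags \<open>(x, M)\<close> partition
  \<open>V - {x}\<close>, which has \<open>q ^ 3\<close> elements, into parts of size
  \<open>q\<^sup>2\<close>.
\<close>

lemma card_flags_at:
  assumes x: "x \<in> V"
  shows "card (flags_at \<Omega> x) = q"
proof -
  define S where "S = {M. (x, M) \<in> \<Omega>}"
  define C where "C = (\<lambda>M. M - {x}) ` S"
  have C: "c \<in> C \<longleftrightarrow> (\<exists>M. (x, M) \<in> \<Omega> \<and> c = M - {x})" for c
    unfolding C_def S_def by blast
  have inj: "inj_on (\<lambda>M. M - {x}) S"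
    unfolding S_def using flag_props(2) by (metis (no_types, lifting) inj_onI insert_Diff mem_Collect_eq)
  have flags_at: "flags_at \<Omega> x = Pair x ` S"
    unfolding flags_at_def S_def by (auto simp: image_iff)
  have "finite S"
    by (rule finite_subset[OF _ finite_imageI[OF finite_Omega, of snd]]) (force simp: S_def)
  have "q\<^sup>2 * card C = card (\<Union>C)"
  proof (rule card_partition)
    show "finite C"
      using \<open>finite S\<close> by (simp add: C_def)
    show "finite (\<Union>C)"
    proof (rule finite_Union[OF \<open>finite C\<close>])
      fix c assume "c \<in> C"
      then obtain M where M: "(x, M) \<in> \<Omega>" "c = M - {x}"
        using C by blast
      show "finite c"
        unfolding M(2) using finite_block[OF M(1)] by (rule finite_Diff)
    qed
    show "card c = q\<^sup>2" if c: "c \<in> C" for c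
    proof -
      obtain M where M: "(x, M) \<in> \<Omega>" "c = M - {x}"
        using c C by blast
      show ?thesis
        unfolding M(2) using flag_props(2,4)[OF M(1)] by simp
    qed
    show "c \<inter> c' = {}" if c: "c \<in> C" "c' \<in> C" "c \<noteq> c'" for c c'
    proof -
      obtain M N where M: "(x, M) \<in> \<Omega>" "c = M - {x}" "(x, N) \<in> \<Omega>" "c' = N - {x}"
        using c(1,2) C by metis
      show ?thesis
        using flags_disjoint[OF M(1,3)] c(3) unfolding M(2,4) by blast
    qed
  qed
  also have "\<Union>C = V - {x}"
  proof
    show "\<Union>C \<subseteq> V - {x}"
    proof
      fix y assume "y \<in> \<Union>C"
      then obtain M where M: "(x, M) \<in> \<Omega>" "y \<in> M - {x}"
        using C by auto
      show "y \<in> V - {x}"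
        using M(2) flag_props(3)[OF M(1)] by auto
    qed
    show "V - {x} \<subseteq> \<Union>C"
    proof
      fix y assume y: "y \<in> V - {x}"
      then obtain M where "(x, M) \<in> \<Omega>" "y \<in> M"
        using flag_through[OF x, of y] by auto
      then show "y \<in> \<Union>C"
        using y C by blast
    qed
  qed
  also have "card (V - {x}) = q\<^sup>2 * q"
    using x finite_V card_V by (simp add: power3_eq_cube power2_eq_square)
  finally have "card C = q"
    using q by simp
  then show ?thesis
    unfolding C_def Finite_Set.card_image[OF inj] flags_at
    by (simp add: Finite_Set.card_image inj_on_def)
qed

lemma card_Omega: "card \<Omega> = q * (q ^ 3 + 1)"
proof -
  have "card \<Omega> = card (\<Union>x\<in>V. flags_at \<Omega> x)"
    using flag_props(1) by (intro arg_cong[where f = card]) (fastforce simp: flags_at_def)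
  also have "\<dots> = (\<Sum>x\<in>V. card (flags_at \<Omega> x))"
    by (rule card_UN_disjoint) (use finite_V finite_Omega in \<open>auto simp: flags_at_def\<close>)
  finally show ?thesis
    using card_flags_at card_V by simp
qed

text \<open>
  If one block carried two flags, the transitivity of flag stabilizers would make every point of
  every block the point of a flag. Then \<open>q\<^sup>2 + 1\<close> would divide the number
  \<open>q * (q ^ 3 + 1)\<close> of flags; but \<open>q ^ 4 + q\<close> leaves the remainder
  \<open>q + 1\<close> modulo \<open>q\<^sup>2 + 1\<close>.
\<close>

lemma nucleus_unique:
  assumes "(x, M) \<in> \<Omega>" "(y, M) \<in> \<Omega>"
  shows "x = y"
proof (rule ccontr)
  assume "x \<noteq> y"
  have M: "(u, M) \<in> \<Omega>" if u: "u \<in> M" for u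
  proof (cases "u = x")
    case False
    obtain g where "g \<in> carrier G" "g x = x" "g ` M = M" "g y = u"
      by (rule flag_stabilizer_transitive[OF assms(1), of y u])
        (use u False \<open>x \<noteq> y\<close> flag_props(2)[OF assms(2)] in auto)
    then show ?thesis using flag_act[OF _ assms(2)] by metis
  qed (use assms in simp)
  have all: "(u, N) \<in> \<Omega>" if "N \<in> B" "u \<in> N" for u N
  proof -
    obtain v where "(v, N) \<in> \<Omega>" by (rule block_flag[OF \<open>N \<in> B\<close>])
    then obtain h where h: "h \<in> carrier G" "h z = v" "h ` L = N" by (rule flagE)
    obtain g where g: "g \<in> carrier G" "g z = x" "g ` L = M" using assms(1) by (rule flagE)
    obtain h' where h': "h' \<in> carrier G" "\<forall>x\<in>V. h' (h x) = x" "\<forall>x\<in>V. h (h' x) = x"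
      using inverse[OF h(1)] by blast
    obtain g' where g': "g' \<in> carrier G" "\<forall>x\<in>V. g' (g x) = x" "\<forall>x\<in>V. g (g' x) = x"
      using inverse[OF g(1)] by blast
    obtain p where p: "p \<in> L" "u = h p" using \<open>u \<in> N\<close> h by auto
    have "(g p, M) \<in> \<Omega>" using M p g by auto
    then have "(g' (g p), g' ` M) \<in> \<Omega>" using flag_act g' by blast
    moreover have "g' ` M = L" using inverse_image[of g' g L] g'(2) L_subset g by simp
    ultimately have "(p, L) \<in> \<Omega>" using g'(2) p L_subset by auto
    then show ?thesis using flag_act[OF h(1), of p L] h p by simp
  qed
  have "(u, N) \<in> \<Omega> \<longleftrightarrow> (u, N) \<in> (SIGMA N:B. N)\<inverse>" for u N
    using all[of N u] flag_props(2,5)[of u N] by (simp; blast)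
  then have "\<Omega> = (SIGMA N:B. N)\<inverse>"
    by (simp only: set_eq_iff split_paired_All simp_thms)
  then have "card \<Omega> = card (SIGMA N:B. N)"
    by (simp add: card_inverse)
  also have "\<dots> = (\<Sum>N\<in>B. card N)"
  proof (rule card_SigmaI[OF finite_B], rule ballI)
    fix N assume "N \<in> B"
    then obtain v where "(v, N) \<in> \<Omega>" by (rule block_flag)
    then show "finite N" by (rule finite_block)
  qed
  also have "\<dots> = card B * (q\<^sup>2 + 1)"
  proof -
    have "card N = q\<^sup>2 + 1" if N: "N \<in> B" for N
    proof -
      obtain v where "(v, N) \<in> \<Omega>" using N by (rule block_flag)
      then show ?thesis by (rule flag_props(4))
    qed
    then show ?thesis by simp
  qed
  finally have "q\<^sup>2 + 1 dvd q * (q ^ 3 + 1)"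
    unfolding card_Omega by (rule dvdI[OF trans[OF _ mult.commute]])
  then have "q\<^sup>2 + 1 dvd q * (q ^ 3 + 1) + (q\<^sup>2 + 1)"
    by (rule dvd_add[OF _ dvd_refl])
  also have "q * (q ^ 3 + 1) + (q\<^sup>2 + 1) = (q\<^sup>2 + 1) * q\<^sup>2 + (q + 1)"
    by (simp add: algebra_simps power2_eq_square power3_eq_cube)
  finally have "q\<^sup>2 + 1 dvd q + 1"
    using dvd_add_right_iff[OF dvd_triv_left, of "q\<^sup>2 + 1" "q\<^sup>2" "q + 1"] by blast
  then have "q\<^sup>2 \<le> q"
    by (auto dest: dvd_imp_le)
  then show False using q by (simp add: power2_eq_square)
qed

lemma card_B: "card B = q * (q ^ 3 + 1)"
proof -
  have "inj_on snd \<Omega>" using nucleus_unique by (auto simp: inj_on_def)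
  moreover have "snd ` \<Omega> = B"
  proof
    show "snd ` \<Omega> \<subseteq> B"
      using flag_props(5) by auto
    show "B \<subseteq> snd ` \<Omega>"
      using block_flag by (metis image_eqI snd_conv subsetI)
  qed
  ultimately show ?thesis
    using card_Omega Finite_Set.card_image[of snd \<Omega>] by simp
qed

section \<open>The design and the flag graph\<close>

lemma image_blocks:
  assumes g: "g \<in> carrier G"
  shows "image g ` B = B"
proof
  have sub: "image h ` B \<subseteq> B" if h: "h \<in> carrier G" for h
  proof
    fix N assume "N \<in> image h ` B"
    then obtain M where M: "M \<in> B" "N = h ` M" by auto
    obtain x where "(x, M) \<in> \<Omega>" using M(1) by (rule block_flag)
    then show "N \<in> B" using flag_props(5)[OF flag_act[OF h]] M(2) by simp
  qed
  show "image g ` B \<subseteq> B" using sub[OF g] .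
  obtain h where h: "h \<in> carrier G" "\<forall>x\<in>V. h (g x) = x" "\<forall>x\<in>V. g (h x) = x"
    using inverse[OF g] by blast
  show "B \<subseteq> image g ` B"
  proof
    fix M assume M: "M \<in> B"
    then obtain x where x: "(x, M) \<in> \<Omega>" by (rule block_flag)
    have "g ` h ` M = M"
      by (rule inverse_image[of g h, OF h(3) flag_props(3)[OF x]])
    then show "M \<in> image g ` B"
      using subsetD[OF sub[OF h(1)] imageI[OF M]] by (metis imageI)
  qed
qed

lemma two_transitive_on: "two_transitive_on G V"
  unfolding two_transitive_on_def transitive_on_def using two_transitive by auto

lemma transitive_on_blocks: "transitive_on G image B"
  unfolding transitive_on_def
proof (intro ballI)
  fix M N assume "M \<in> B" "N \<in> B"
  then obtain x y where flags: "(x, M) \<in> \<Omega>" "(y, N) \<in> \<Omega>"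
    using block_flag by metis
  obtain g where g: "g \<in> carrier G" "g z = x" "g ` L = M" using flags(1) by (rule flagE)
  obtain h where h: "h \<in> carrier G" "h z = y" "h ` L = N" using flags(2) by (rule flagE)
  obtain g' where g': "g' \<in> carrier G" "\<forall>x\<in>V. g' (g x) = x"
    using inverse[OF g(1)] by blast
  have "g' ` M = L"
    using inverse_image[of g' g, OF g'(2) L_subset] g(3) by simp
  then have "compose V h g' ` M = N"
    using compose_image[OF flag_props(3)[OF flags(1)], of h g'] h(3) by simp
  then show "\<exists>g\<in>carrier G. g ` M = N"
    using compose[OF h(1) g'(1)] by blast
qed

lemma automorphism_group: "automorphism_group G (V, B)"
  unfolding automorphism_group_def automorphisms_def prod.case fst_conv
proof (intro conjI subsetI CollectI)
  show "subgroup (carrier G) (BijGroup V)"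
    by (rule subgroup)
  show "g \<in> Bij V" "image g ` B = B" if "g \<in> carrier G" for g
    by (rule Bij[OF that], rule image_blocks[OF that])
qed

text \<open>
  By \<open>2\<close>-transitivity the number does not depend on the pair, so it can be found by
  counting the triples of two distinct points and a block through them in two ways.
\<close>

lemma card_blocks_through:
  assumes "x \<in> V" "y \<in> V" "x \<noteq> y"
  shows "card {M \<in> B. x \<in> M \<and> y \<in> M} = q\<^sup>2 + 1"
proof -
  define X where "X = {(u, v). u \<in> V \<and> v \<in> V \<and> u \<noteq> v}"
  define R where "R = (\<lambda>(p :: 'v \<times> 'v) M. fst p \<in> M \<and> snd p \<in> M)"
  have le: "card {M \<in> B. R p M} \<le> card {M \<in> B. R p' M}" if p: "p \<in> X" "p' \<in> X" for p p'
  proof -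
    obtain g where g: "g \<in> carrier G" "g (fst p) = fst p'" "g (snd p) = snd p'"
      using two_transitive[of "fst p" "snd p" "fst p'" "snd p'"] p by (auto simp: X_def)
    have sub: "M \<subseteq> V" if M: "M \<in> B" for M
    proof -
      obtain x where "(x, M) \<in> \<Omega>" using M by (rule block_flag)
      then show ?thesis by (rule flag_props(3))
    qed
    show ?thesis
    proof (rule card_inj_on_le)
      show "inj_on (image g) {M \<in> B. R p M}"
        using sub inj_on[OF g(1)] by (auto simp: inj_on_def inj_on_image_eq_iff)
      show "image g ` {M \<in> B. R p M} \<subseteq> {M \<in> B. R p' M}"
      proof
        fix N assume "N \<in> image g ` {M \<in> B. R p M}"
        then obtain M where M: "N = g ` M" "M \<in> B" "fst p \<in> M" "snd p \<in> M"
          by (auto simp: R_def)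
        then have "g (fst p) \<in> N" "g (snd p) \<in> N"
          by simp_all
        then show "N \<in> {M \<in> B. R p' M}"
          using image_blocks[OF g(1)] M(1,2) g(2,3) by (auto simp: R_def)
      qed
      show "finite {M \<in> B. R p' M}"
        using finite_B by simp
    qed
  qed
  have xy: "(x, y) \<in> X"
    using assms by (simp add: X_def)
  have const: "card {M \<in> B. R p M} = card {M \<in> B. R (x, y) M}" if p: "p \<in> X" for p
    using le[OF p xy] le[OF xy p] by (rule le_antisym)
  have cX: "card X = (q ^ 3 + 1) * q ^ 3"
    unfolding X_def using card_offdiagonal[OF finite_V] card_V by simp
  have "X \<subseteq> V \<times> V" by (auto simp: X_def)
  then have finX: "finite X" using finite_V finite_subset by blast
  have "(\<Sum>p\<in>X. card {M \<in> B. R p M}) = (\<Sum>M\<in>B. (q\<^sup>2 + 1) * q\<^sup>2)"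
  proof (rule sum_multicount_gen[OF finX finite_B], rule ballI)
    fix M assume "M \<in> B"
    then obtain v where v: "(v, M) \<in> \<Omega>" by (rule block_flag)
    have "{p \<in> X. R p M} = {(u, v). u \<in> M \<and> v \<in> M \<and> u \<noteq> v}"
      using flag_props(3)[OF v] by (auto simp: X_def R_def)
    then show "card {p \<in> X. R p M} = (q\<^sup>2 + 1) * q\<^sup>2"
      using card_offdiagonal[OF finite_block[OF v]] flag_props(4)[OF v] by simp
  qed
  also have "(\<Sum>p\<in>X. card {M \<in> B. R p M}) = (q ^ 3 + 1) * q ^ 3 * card {M \<in> B. R (x, y) M}"
    using const by (simp add: cX)
  also have "(\<Sum>M\<in>B. (q\<^sup>2 + 1) * q\<^sup>2) = q * (q ^ 3 + 1) * ((q\<^sup>2 + 1) * q\<^sup>2)"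
    by (simp only: sum_constant card_B of_nat_id)
  also have "q * a * (b * q\<^sup>2) = a * q ^ 3 * b" for a b
    by (simp add: power2_eq_square power3_eq_cube mult_ac)
  finally have "(q ^ 3 + 1) * q ^ 3 * card {M \<in> B. R (x, y) M} = (q ^ 3 + 1) * q ^ 3 * (q\<^sup>2 + 1)" .
  moreover have "(q ^ 3 + 1) * q ^ 3 \<noteq> 0"
    using q by simp
  ultimately have "card {M \<in> B. R (x, y) M} = q\<^sup>2 + 1"
    by (rule mult_left_cancel[THEN iffD1, rotated])
  then show ?thesis by (simp add: R_def)
qed

lemma is_design: "is_design 2 (q ^ 3 + 1) (q\<^sup>2 + 1) (q\<^sup>2 + 1) (V, B)"
  unfolding is_design_def prod.case
proof (intro conjI ballI allI impI)
  fix M assume "M \<in> B"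
  then obtain v where v: "(v, M) \<in> \<Omega>" by (rule block_flag)
  show "M \<subseteq> V" "card M = q\<^sup>2 + 1"
    using flag_props[OF v] by simp_all
next
  fix T assume T: "T \<subseteq> V \<and> card T = 2"
  then obtain x y where xy: "T = {x, y}" "x \<noteq> y"
    by (auto simp: card_2_iff)
  then have "{M \<in> B. T \<subseteq> M} = {M \<in> B. x \<in> M \<and> y \<in> M}"
    by auto
  then show "card {M \<in> B. T \<subseteq> M} = q\<^sup>2 + 1"
    using card_blocks_through[of x y] T xy by simp
qed (use finite_V card_V in simp_all)

lemma flag_orbit: "flag_orbit G (V, B) \<Omega>"
  unfolding flag_orbit_def
proof
  show "(z, L) \<in> flags (V, B)"
    using flag_props(1,2,5)[OF base_flag] by (simp add: flags_def)
qed (rule \<Omega>)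

lemma one_feasible: "one_feasible G (V, B) \<Omega>"
  unfolding one_feasible_def fst_conv
proof (intro conjI ballI allI impI)
  fix F assume F: "F \<in> \<Omega>"
  obtain x M where xM: "F = (x, M)" by (cases F)
  show "case F of (x, L) \<Rightarrow> transitive_on (stab_group (stab_group G (\<lambda>g. g) x) image L) (\<lambda>g. g) (L - {x})"
    unfolding xM prod.case transitive_on_def
  proof (intro ballI)
    fix y y' assume y: "y \<in> M - {x}" "y' \<in> M - {x}"
    obtain g where g: "g \<in> carrier G" "g x = x" "g ` M = M" "g y = y'"
      by (rule flag_stabilizer_transitive[OF F[unfolded xM] y])
    show "\<exists>g\<in>carrier (stab_group (stab_group G (\<lambda>g. g) x) image M). g y = y'"
      by (rule bexI[of _ g]) (use g in \<open>simp_all add: stab_group_def stabilizer_def\<close>)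
  qed
next
  fix x M N
  assume "(x, M) \<in> flags_at \<Omega> x \<and> (x, N) \<in> flags_at \<Omega> x \<and> M \<noteq> N"
  then have f: "(x, M) \<in> \<Omega>" "(x, N) \<in> \<Omega>" "M \<noteq> N"
    by (simp_all add: flags_at_def)
  then have "y = x" if "y \<in> M" "y \<in> N" for y
    using flags_disjoint[OF f(1,2) that] by blast
  then show "M \<inter> N = {x}"
    using flag_props(2)[OF f(1)] flag_props(2)[OF f(2)] by blast
next
  show "flag_orbit G (V, B) \<Omega>"
    by (rule flag_orbit)
  show "2 \<le> card (flags_at \<Omega> x)" if "x \<in> V" for x
    using card_flags_at[OF that] q by simp
qed

lemma mem_flag_pairs:
  "((x, M), (y, N)) \<in> flag_pairs \<Omega> \<longleftrightarrow>
    (x, M) \<in> \<Omega> \<and> (y, N) \<in> \<Omega> \<and> x \<noteq> y \<and> x \<in> N \<and> y \<in> M"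
  unfolding flag_pairs_def using flag_props(2)[of x M] flag_props(2)[of y N] by auto

lemma flag_pairs_sym: "(F, F') \<in> flag_pairs \<Omega> \<Longrightarrow> (F', F) \<in> flag_pairs \<Omega>"
  by (cases F; cases F') (auto simp: mem_flag_pairs)

lemma flag_pairs_act:
  assumes g: "g \<in> carrier G" and FF': "(F, F') \<in> flag_pairs \<Omega>"
  shows "(flag_act g F, flag_act g F') \<in> flag_pairs \<Omega>"
proof -
  obtain x M y N where eq: "F = (x, M)" "F' = (y, N)" by (cases F; cases F')
  then have "(x, M) \<in> \<Omega>" "(y, N) \<in> \<Omega>" "x \<noteq> y" "x \<in> N" "y \<in> M"
    using FF' mem_flag_pairs by simp_all
  then show ?thesis
    using flag_act[OF g] eq_iff[OF g, of x y] flag_props(1)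
    unfolding eq by (simp add: flag_act_def mem_flag_pairs)
qed

text \<open>
  An arc \<open>((x, M), (y, N))\<close> is determined by the ordered pair \<open>(x, y)\<close>,
  because \<open>M\<close> is the block of the flag at \<open>x\<close> through \<open>y\<close>
  and \<open>N\<close> that of the flag at \<open>y\<close> through \<open>x\<close>. So
  \<open>2\<close>-transitivity on points is transitivity on arcs.
\<close>

lemma self_paired_orbit: "self_paired_orbit G \<Omega> (flag_pairs \<Omega>)"
  unfolding self_paired_orbit_def
proof
  have "P \<noteq> {}" using card_P q by auto
  then obtain p where p: "p \<in> P" by auto
  then have pV: "p \<in> V" "p \<noteq> z" "p \<in> L" using P L by auto
  obtain N where N: "(p, N) \<in> \<Omega>" "z \<in> N"
    using flag_through[of p z] pV z by blast
  have arc: "((z, L), (p, N)) \<in> flag_pairs \<Omega>"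
    using base_flag N pV by (simp add: mem_flag_pairs)
  have "flag_pairs \<Omega> = Group_Action.orbit G (\<lambda>g. map_prod (flag_act g) (flag_act g)) ((z, L), (p, N))"
  proof
    show "Group_Action.orbit G (\<lambda>g. map_prod (flag_act g) (flag_act g)) ((z, L), (p, N)) \<subseteq> flag_pairs \<Omega>"
      using flag_pairs_act[OF _ arc] by (auto simp: Group_Action.orbit_def)
    show "flag_pairs \<Omega> \<subseteq> Group_Action.orbit G (\<lambda>g. map_prod (flag_act g) (flag_act g)) ((z, L), (p, N))"
    proof
      fix A assume A: "A \<in> flag_pairs \<Omega>"
      obtain x M y M' where eq: "A = ((x, M), (y, M'))" by (metis surj_pair)
      then have f: "(x, M) \<in> \<Omega>" "(y, M') \<in> \<Omega>" "x \<noteq> y" "x \<in> M'" "y \<in> M"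
        using A mem_flag_pairs by simp_all
      then obtain g where g: "g \<in> carrier G" "g z = x" "g p = y"
        using two_transitive[of z p x y] z pV flag_props(1) by metis
      have "(x, g ` L) \<in> \<Omega>" "(y, g ` N) \<in> \<Omega>"
        using flag_act[OF g(1) base_flag] flag_act[OF g(1) N(1)] g by simp_all
      moreover have "y \<in> g ` L" "x \<in> g ` N"
        using g pV N by auto
      ultimately have "g ` L = M" "g ` N = M'"
        using flags_disjoint[of x "g ` L" M y] flags_disjoint[of y "g ` N" M' x] f by auto
      then have "A = map_prod (flag_act g) (flag_act g) ((z, L), (p, N))"
        using g eq by (simp add: flag_act_def)
      then show "A \<in> Group_Action.orbit G (\<lambda>g. map_prod (flag_act g) (flag_act g)) ((z, L), (p, N))"
        using g(1) by (auto simp: Group_Action.orbit_def)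
    qed
  qed
  then show "\<exists>A\<in>\<Omega> \<times> \<Omega>. flag_pairs \<Omega> = Group_Action.orbit G (\<lambda>g. map_prod (flag_act g) (flag_act g)) A"
    using base_flag N by blast
  show "(flag_pairs \<Omega>)\<inverse> = flag_pairs \<Omega>"
    using flag_pairs_sym by auto
qed

lemma out_degree:
  assumes "F \<in> \<Omega>"
  shows "out_degree (with_proj (flag_graph \<Omega> (flag_pairs \<Omega>))) F = q\<^sup>2"
proof -
  obtain x M where F: "F = (x, M)" by (cases F)
  then have xM: "(x, M) \<in> \<Omega>" using assms by simp
  define A where "A = {a \<in> flag_pairs \<Omega>. fst a = (x, M)}"
  have A: "a \<in> A \<longleftrightarrow> (\<exists>y N. a = ((x, M), (y, N)) \<and> (y, N) \<in> \<Omega> \<and> x \<noteq> y \<and> x \<in> N \<and> y \<in> M)" for a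
  proof -
    obtain u K y N where "a = ((u, K), (y, N))" by (metis surj_pair)
    then show ?thesis using xM by (auto simp: A_def mem_flag_pairs)
  qed
  have "inj_on (\<lambda>a. fst (snd a)) A"
  proof (rule inj_onI)
    fix a a' assume "a \<in> A" "a' \<in> A" and eq: "fst (snd a) = fst (snd a')"
    then obtain y N y' N' where a: "a = ((x, M), (y, N))" "(y, N) \<in> \<Omega>" "x \<noteq> y" "x \<in> N"
      and a': "a' = ((x, M), (y', N'))" "(y', N') \<in> \<Omega>" "x \<in> N'"
      unfolding A by blast
    then have "y = y'" using eq by simp
    then show "a = a'"
      using flags_disjoint[of y N N' x] a a' by simp
  qed
  moreover have "(\<lambda>a. fst (snd a)) ` A = M - {x}"
  proof
    show "(\<lambda>a. fst (snd a)) ` A \<subseteq> M - {x}"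
      using A by force
    show "M - {x} \<subseteq> (\<lambda>a. fst (snd a)) ` A"
    proof
      fix y assume y: "y \<in> M - {x}"
      then have "y \<in> V" using flag_props(3)[OF xM] by auto
      then obtain N where N: "(y, N) \<in> \<Omega>" "x \<in> N"
        using flag_through[of y x] y flag_props(1)[OF xM] by blast
      then have "((x, M), (y, N)) \<in> A"
        using y unfolding A by blast
      then show "y \<in> (\<lambda>a. fst (snd a)) ` A" by force
    qed
  qed
  ultimately have "card A = card (M - {x})"
    using Finite_Set.card_image by metis
  then have "card A = q\<^sup>2"
    using flag_props(2,4)[OF xM] by simp
  then show ?thesis
    by (simp add: out_degree_def out_arcs_def flag_graph_def A_def F)
qed

text \<open>
  One coincidence of points suffices for connectedness: a path between two different flags at a
  point is moved to a path from \<open>(z, L)\<close> to another flag at \<open>z\<close>, then by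
  the stabilizer of \<open>(z, L)\<close> to paths to all flags at \<open>z\<close>, and by the
  group to every point. Since any two points are the points of the ends of an arc, everything is
  connected.
\<close>

lemma connected_flag_graph:
  assumes dup: "(x, M) \<in> \<Omega>" "(x, N) \<in> \<Omega>" "M \<noteq> N" "((x, M), (x, N)) \<in> (flag_pairs \<Omega>)\<^sup>*"
    and trans: "\<And>M N. \<lbrakk>(z, M) \<in> \<Omega>; (z, N) \<in> \<Omega>; M \<noteq> L; N \<noteq> L\<rbrakk> \<Longrightarrow>
      \<exists>g\<in>carrier G. g z = z \<and> g ` L = L \<and> g ` M = N"
  shows "connected (with_proj (flag_graph \<Omega> (flag_pairs \<Omega>)))"
proof -
  have act: "(flag_act g F, flag_act g F') \<in> (flag_pairs \<Omega>)\<^sup>*"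
    if "(F, F') \<in> (flag_pairs \<Omega>)\<^sup>*" "g \<in> carrier G" for g F F'
    using that(1)
  proof induction
    case (step F' F'')
    then show ?case using flag_pairs_act[OF that(2)] by (meson rtrancl.rtrancl_into_rtrancl)
  qed simp
  have sym: "(F', F) \<in> (flag_pairs \<Omega>)\<^sup>*" if "(F, F') \<in> (flag_pairs \<Omega>)\<^sup>*" for F F'
    using that by (rule symD[OF sym_rtrancl, rotated]) (simp add: flag_pairs_sym symI)
  obtain K where K: "(z, K) \<in> \<Omega>" "K \<noteq> L" "((z, L), (z, K)) \<in> (flag_pairs \<Omega>)\<^sup>*"
  proof -
    obtain g where g: "g \<in> carrier G" "g z = x" "g ` L = M" using dup(1) by (rule flagE)
    obtain h where h: "h \<in> carrier G" "\<forall>x\<in>V. h (g x) = x" "\<forall>x\<in>V. g (h x) = x"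
      using inverse[OF g(1)] by blast
    have hx: "h x = z" using bspec[OF h(2) z] g(2) by simp
    have hM: "h ` M = L" using inverse_image[of h g, OF h(2) L_subset] g(3) by simp
    have ghN: "g ` h ` N = N" by (rule inverse_image[of g h, OF h(3) flag_props(3)[OF dup(2)]])
    show thesis
    proof
      show "(z, h ` N) \<in> \<Omega>" using flag_act[OF h(1) dup(2)] hx by simp
      show "h ` N \<noteq> L" using ghN g(3) dup(3) by metis
      show "((z, L), (z, h ` N)) \<in> (flag_pairs \<Omega>)\<^sup>*"
        using act[OF dup(4) h(1)] by (simp add: flag_act_def hx hM)
    qed
  qed
  have base: "((z, L), (z, N)) \<in> (flag_pairs \<Omega>)\<^sup>*" if N: "(z, N) \<in> \<Omega>" for N
  proof (cases "N = L")
    case False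
    then obtain g where g: "g \<in> carrier G" "g z = z" "g ` L = L" "g ` K = N"
      using trans[OF K(1) N K(2)] by blast
    then show ?thesis using act[OF K(3) g(1)] by (simp add: flag_act_def)
  qed simp
  have same_point: "((x, M), (x, N)) \<in> (flag_pairs \<Omega>)\<^sup>*" if f: "(x, M) \<in> \<Omega>" "(x, N) \<in> \<Omega>" for x M N
  proof -
    obtain g where g: "g \<in> carrier G" "g z = x" "g ` L = M" using f(1) by (rule flagE)
    obtain h where h: "h \<in> carrier G" "\<forall>x\<in>V. h (g x) = x" "\<forall>x\<in>V. g (h x) = x"
      using inverse[OF g(1)] by blast
    have hx: "h x = z" using bspec[OF h(2) z] g(2) by simp
    have ghN: "g ` h ` N = N" by (rule inverse_image[of g h, OF h(3) flag_props(3)[OF f(2)]])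
    have "((z, L), (z, h ` N)) \<in> (flag_pairs \<Omega>)\<^sup>*"
      using base flag_act[OF h(1) f(2)] hx by simp
    from act[OF this g(1)] show ?thesis
      by (simp add: flag_act_def g ghN)
  qed
  have all: "(F, F') \<in> (flag_pairs \<Omega>)\<^sup>*" if F: "F \<in> \<Omega>" "F' \<in> \<Omega>" for F F'
  proof -
    obtain x M y N where eq: "F = (x, M)" "F' = (y, N)" by (cases F; cases F')
    note f = F[unfolded eq]
    show ?thesis
    proof (cases "x = y")
      case True
      then show ?thesis using same_point f eq by simp
    next
      case False
      have V: "x \<in> V" "y \<in> V" using flag_props(1) f by simp_all
      obtain M' where M': "(x, M') \<in> \<Omega>" "y \<in> M'" by (rule flag_through[OF V False])
      obtain N' where N': "(y, N') \<in> \<Omega>" "x \<in> N'" by (rule flag_through[OF V(2,1) False[symmetric]])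
      have "((x, M'), (y, N')) \<in> flag_pairs \<Omega>"
        using M' N' False by (simp add: mem_flag_pairs)
      then show ?thesis
        using same_point[OF f(1) M'(1)] same_point[OF N'(1) f(2)] unfolding eq
        by (meson rtrancl.rtrancl_into_rtrancl rtrancl_trans)
    qed
  qed
  define H where "H = mk_symmetric (with_proj (flag_graph \<Omega> (flag_pairs \<Omega>)))"
  have H: "pverts H = \<Omega>" "flag_pairs \<Omega> \<subseteq> parcs H"
    by (auto simp: H_def mk_symmetric_def flag_graph_def)
  have reach: "(F, F') \<in> rtrancl_on \<Omega> (parcs H)" if "(F, F') \<in> (flag_pairs \<Omega>)\<^sup>*" "F \<in> \<Omega>" for F F'
    using that
  proof induction
    case (step F' F'')
    have "F'' \<in> \<Omega>" using step(2) by (cases F'; cases F'') (simp add: mem_flag_pairs)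
    then show ?case using step H(2) by (auto intro: rtrancl_on_into_rtrancl_on)
  qed simp
  show ?thesis
    unfolding connected_def strongly_connected_def reachable_def H_def[symmetric] with_proj_simps H(1)
  proof (intro conjI ballI)
    show "\<Omega> \<noteq> {}" using base_flag by blast
    show "(F, F') \<in> rtrancl_on \<Omega> (parcs H)" if "F \<in> \<Omega>" "F' \<in> \<Omega>" for F F'
      by (rule reach[OF all[OF that] that(1)])
  qed
qed

end

section \<open>Identities in characteristic three\<close>

text \<open>
  Rewriting numerals to \<open>-1\<close>, \<open>0\<close> or \<open>1\<close> lets the
  simplifier prove polynomial identities modulo \<open>3\<close> after expansion.
\<close>

lemma residues_mod_3:
  assumes "(3::'a::comm_ring_1) = 0"
  shows "(2::'a) = -1" "(4::'a) = 1" "(5::'a) = -1" "(6::'a) = 0" "(7::'a) = 1" "(8::'a) = -1" "(9::'a) = 0"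
proof -
  have "(2::'a) = 3 - 1" "(4::'a) = 3 + 1" "(5::'a) = 2 * 3 - 1" "(6::'a) = 2 * 3"
      "(7::'a) = 2 * 3 + 1" "(8::'a) = 3 * 3 - 1" "(9::'a) = 3 * 3"
    by simp_all
  then show "(2::'a) = -1" "(4::'a) = 1" "(5::'a) = -1" "(6::'a) = 0" "(7::'a) = 1"
      "(8::'a) = -1" "(9::'a) = 0"
    unfolding assms by simp_all
qed

lemmas expand = algebra_simps power2_eq_square power3_eq_cube power4_eq_xxxx

text \<open>
  All twisted quantities below have the form \<open>u + A * w\<close>, where \<open>A\<close>
  stands for \<open>s a\<close> and \<open>u\<close>, \<open>w\<close> are polynomials in the
  remaining variables. Relations that are linear in them can therefore be checked separately for
  the coefficients of \<open>1\<close> and of \<open>A\<close>.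
\<close>

lemma combine_twisted:
  fixes A :: "'a::comm_ring_1"
  assumes "u * j = x * u' - y * u''" "w * j = x * w' - y * w''"
  shows "(u + A * w) * j = x * (u' + A * w') - y * (u'' + A * w'')"
proof -
  have "(u + A * w) * j = u * j + A * (w * j)"
    by (simp add: algebra_simps)
  then show ?thesis
    unfolding assms by (simp add: algebra_simps)
qed

text \<open>
  Here \<open>l1\<close>, \<open>l2\<close>, \<open>l3\<close> stand for
  \<open>\<lambda>\<^sub>1\<close>, \<open>\<lambda>\<^sub>2\<close>,
  \<open>\<lambda>\<^sub>3\<close>, with \<open>l3\<close> eliminated by the equation of the
  invariant quadric. The vectors \<open>(1, 0, M, N, b ^ 3, U5, U6)\<close> and
  \<open>(0, 1, a ^ 3, M, - N, W5, W6)\<close> span a line that contains the vector of the twisted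
  coordinates, at the parameter \<open>A = s a\<close>.
\<close>

context
  fixes a b c l1 l2 l3 M N U5 U6 W5 W6 :: "'a::comm_ring_1"
  assumes three: "(3::'a) = 0"
    and l3: "l3 = - (c^2 + a * l2 + b * l1)"
    and MN: "M = l1 - a^2 * b + a * c" "N = a * b^2 + b * c - l2"
    and U: "U5 = M * N + a ^ 3 * b ^ 3 - c ^ 3" "U6 = - (N^2) - M * b ^ 3"
    and W: "W5 = a ^ 3 * N - M^2" "W6 = c ^ 3 + a ^ 3 * b ^ 3 + M * N"
begin

lemma twisted_lam3:
  "- ((N + A * M)^2 + A * (U5 + A * W5) + (M + A * a ^ 3) * (b ^ 3 + A * (- N))) = U6 + A * W6"
proof -
  have "- ((N + A * M)^2 + A * (U5 + A * W5) + (M + A * a ^ 3) * (b ^ 3 + A * (- N)))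
      = U6 + A * W6 - 3 * (A * (M * N + a ^ 3 * b ^ 3))"
    unfolding U W by (simp add: algebra_simps power2_eq_square)
  then show ?thesis
    by (simp add: three)
qed

text \<open>
  The terms linear in \<open>A\<close> are the twisted coordinates of \<open>l1\<close>,
  \<open>l2\<close>, \<open>l3\<close>. In these terms this is the defining equation of
  \<open>\<lambda>\<^sub>1\<close>, homogenized and read with the order of the coordinates
  reversed.
\<close>

lemma reversed_lam1_poly:
  "(U6 + A * W6) * (l3^2 * b - l2^2 * l1 + l2 * l3 * c) =
    l3 ^ 3 * (b ^ 3 + A * (- N)) - l2 ^ 3 * (U5 + A * W5)"
proof (rule combine_twisted)
  have "U6 * (l3^2 * b - l2^2 * l1 + l2 * l3 * c) - (l3 ^ 3 * b ^ 3 - l2 ^ 3 * U5) = 0"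
    unfolding U MN l3 by (simp add: expand three residues_mod_3[OF three])
  then show "U6 * (l3^2 * b - l2^2 * l1 + l2 * l3 * c) = l3 ^ 3 * b ^ 3 - l2 ^ 3 * U5"
    by (rule eq_iff_diff_eq_0[THEN iffD2])
  have "W6 * (l3^2 * b - l2^2 * l1 + l2 * l3 * c) - (l3 ^ 3 * (- N) - l2 ^ 3 * W5) = 0"
    unfolding W MN l3 by (simp add: expand three residues_mod_3[OF three])
  then show "W6 * (l3^2 * b - l2^2 * l1 + l2 * l3 * c) = l3 ^ 3 * (- N) - l2 ^ 3 * W5"
    by (rule eq_iff_diff_eq_0[THEN iffD2])
qed

text \<open>
  The same for the defining equation of \<open>\<lambda>\<^sub>2\<close>, after the twisted
  coordinate of \<open>b\<close> has been eliminated from it with the equation of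
  \<open>\<lambda>\<^sub>1\<close>.
\<close>

lemma reversed_lam2_poly:
  "(U6 + A * W6) * (a * l3^2 - l1^2 * l2 - c * l1 * l3) =
    (b * l3^2 - l1 * l2^2 + c * l2 * l3) * (U5 + A * W5) - l3 ^ 3 * (N + A * M)"
proof (rule combine_twisted)
  have "U6 * (a * l3^2 - l1^2 * l2 - c * l1 * l3) -
      ((b * l3^2 - l1 * l2^2 + c * l2 * l3) * U5 - l3 ^ 3 * N) = 0"
    unfolding U MN l3 by (simp add: expand three residues_mod_3[OF three])
  then show "U6 * (a * l3^2 - l1^2 * l2 - c * l1 * l3) =
      (b * l3^2 - l1 * l2^2 + c * l2 * l3) * U5 - l3 ^ 3 * N"
    by (rule eq_iff_diff_eq_0[THEN iffD2])
  have "W6 * (a * l3^2 - l1^2 * l2 - c * l1 * l3) -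
      ((b * l3^2 - l1 * l2^2 + c * l2 * l3) * W5 - l3 ^ 3 * M) = 0"
    unfolding W MN l3 by (simp add: expand three residues_mod_3[OF three])
  then show "W6 * (a * l3^2 - l1^2 * l2 - c * l1 * l3) =
      (b * l3^2 - l1 * l2^2 + c * l2 * l3) * W5 - l3 ^ 3 * M"
    by (rule eq_iff_diff_eq_0[THEN iffD2])
qed

text \<open>
  The right-hand side contains the twisted coordinate of \<open>l2\<close>, which vanishes with
  \<open>l2\<close>; the left-hand side is \<open>l1 ^ 3\<close> times the twisted coordinate of
  \<open>l1\<close>. So \<open>l1\<close> vanishes too.
\<close>

lemma lam1_vanishing_poly:
  assumes "l3 = 0" "l2 = 0"
  shows "l1 ^ 3 * (b ^ 3 + A * (- N)) = b * c * l1 * (U5 + A * W5)"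
proof -
  have c2: "c * c = - (b * l1)"
    using assms l3 by (simp add: power2_eq_square add_eq_0_iff eq_neg_iff_add_eq_0)
  \<comment> \<open>The quadric with \<open>l2 = l3 = 0\<close>; the second form lets the simplifier reach
    inside products.\<close>
  have c2': "c * (c * x) = - (b * (l1 * x))" for x
    using c2 by (metis mult.assoc mult_minus_left)
  have "b * c * l1 * (U5 + A * W5) - l1 ^ 3 * (b ^ 3 + A * (- N)) = 0"
    unfolding U W MN assms by (simp add: expand three residues_mod_3[OF three] c2 c2')
  then show ?thesis by simp
qed

end

section \<open>A bilinear and a trilinear form in seven dimensions\<close>

lemma all_less_7: "(\<forall>i<7. Q i) \<longleftrightarrow> Q 0 \<and> Q 1 \<and> Q 2 \<and> Q 3 \<and> Q 4 \<and> Q 5 \<and> Q (6::nat)"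
  by (simp add: numeral_eq_Suc All_less_Suc conj_ac)

text \<open>
  The polar form of the quadric \<open>u 0 * u 6 + u 1 * u 5 + u 2 * u 4 + (u 3)\<^sup>2\<close>;
  its coefficient \<open>2\<close> at \<open>u 3 * v 3\<close> is \<open>-1\<close> in
  characteristic \<open>3\<close>.
\<close>

definition bil :: "(nat \<Rightarrow> 'a) \<Rightarrow> (nat \<Rightarrow> 'a) \<Rightarrow> 'a::comm_ring_1" where
  "bil u v = u 0 * v 6 + u 6 * v 0 + u 1 * v 5 + u 5 * v 1 + u 2 * v 4 + u 4 * v 2 - u 3 * v 3"

definition minor :: "nat \<Rightarrow> nat \<Rightarrow> nat \<Rightarrow> (nat \<Rightarrow> 'a) \<Rightarrow> (nat \<Rightarrow> 'a) \<Rightarrow> (nat \<Rightarrow> 'a) \<Rightarrow> 'a::comm_ring_1" where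
  "minor i j k u v w =
    u i * (v j * w k - v k * w j) - u j * (v i * w k - v k * w i) + u k * (v i * w j - v j * w i)"

text \<open>
  The alternating trilinear form that defines the group of type \<open>G\<^sub>2\<close>, which
  contains the Ree group, in its seven-dimensional representation. The five index triples are
  those of total weight zero under the torus of the \<open>n\<close>.
\<close>

definition tri :: "(nat \<Rightarrow> 'a) \<Rightarrow> (nat \<Rightarrow> 'a) \<Rightarrow> (nat \<Rightarrow> 'a) \<Rightarrow> 'a::comm_ring_1" where
  "tri u v w = minor 0 3 6 u v w - minor 1 3 5 u v w - minor 2 3 4 u v w
    + minor 0 4 5 u v w + minor 1 2 6 u v w"

lemma bil_scale:
  assumes "\<forall>i<7. u i = k * u' i" "\<forall>i<7. v i = l * v' i"
  shows "bil u v = k * l * bil u' v'"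
  using assms unfolding all_less_7 bil_def by (simp add: algebra_simps)

lemma minor_scale:
  assumes "\<forall>i<7. u i = k * u' i" "\<forall>i<7. v i = l * v' i" "\<forall>i<7. w i = m * w' i"
    "i < 7" "i' < 7" "i'' < 7"
  shows "minor i i' i'' u v w = k * l * m * minor i i' i'' u' v' w'"
proof -
  have "u i = k * u' i" "u i' = k * u' i'" "u i'' = k * u' i''"
    "v i = l * v' i" "v i' = l * v' i'" "v i'' = l * v' i''"
    "w i = m * w' i" "w i' = m * w' i'" "w i'' = m * w' i''"
    using assms by blast+
  then show ?thesis
    unfolding minor_def by (simp add: algebra_simps)
qed

lemma tri_scale:
  assumes "\<forall>i<7. u i = k * u' i" "\<forall>i<7. v i = l * v' i" "\<forall>i<7. w i = m * w' i"
  shows "tri u v w = k * l * m * tri u' v' w'"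
  unfolding tri_def by (simp add: minor_scale[OF assms] algebra_simps)

lemmas form_defs = bil_def tri_def minor_def

text \<open>
  The formulas for \<open>\<lambda>\<^sub>1\<close>, \<open>\<lambda>\<^sub>2\<close>,
  \<open>\<lambda>\<^sub>3\<close> with independent variables \<open>A\<close>, \<open>B\<close>,
  \<open>C\<close> for \<open>s a\<close>, \<open>s b\<close>, \<open>s c\<close>.
\<close>

definition lam1_poly where "lam1_poly a b c A B C = a\<^sup>2 * b - a * c + B - a ^ 3 * (A::'a::comm_ring_1)"
definition lam2_poly where "lam2_poly a b c A B C = A * B - C + a * b\<^sup>2 + b * c - A\<^sup>2 * (a::'a::comm_ring_1) ^ 3"
definition lam3_poly where "lam3_poly a b c A B C = a * C - a * A * B + a ^ 3 * A * b + a\<^sup>2 * b\<^sup>2 - b * B - c\<^sup>2 + A\<^sup>2 * (a::'a::comm_ring_1) ^ 4"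

text \<open>
  The linear maps that induce \<open>ree_t e 0 \<beta> \<gamma>\<close> (with
  \<open>\<beta>'\<close>, \<open>\<gamma>'\<close> for \<open>s \<beta>\<close>,
  \<open>s \<gamma>\<close>) and \<open>ree_t e \<alpha> 0 0\<close> (with \<open>t\<close> for
  \<open>s \<alpha>\<close>). The general \<open>ree_t\<close> is a product of two such maps.
\<close>

definition translation_matrix :: "'a \<Rightarrow> 'a \<Rightarrow> 'a \<Rightarrow> 'a \<Rightarrow> (nat \<Rightarrow> 'a) \<Rightarrow> nat \<Rightarrow> 'a::comm_ring_1" where
  "translation_matrix \<beta> \<gamma> \<beta>' \<gamma>' u = (!) [u 0, u 1, u 2 + \<beta> * u 0, u 3 + \<gamma> * u 0 + \<beta> * u 1, u 4 + \<beta>' * u 0 - \<gamma> * u 1,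
    u 5 + (\<beta> * \<gamma> - \<gamma>') * u 0 - \<beta>\<^sup>2 * u 1 + \<gamma> * u 2 + \<beta> * u 3,
    u 6 - (\<beta> * \<beta>' + \<gamma>\<^sup>2) * u 0 + (\<beta> * \<gamma> + \<gamma>') * u 1 - \<beta>' * u 2 + \<gamma> * u 3 - \<beta> * u 4]"

definition shear_matrix :: "'a \<Rightarrow> 'a \<Rightarrow> (nat \<Rightarrow> 'a) \<Rightarrow> nat \<Rightarrow> 'a::comm_ring_1" where
  "shear_matrix \<alpha> t u = (!) [u 0, u 1 + \<alpha> * u 0, u 2 + t * u 1, u 3 - \<alpha> * u 2 - t * \<alpha> * u 1,
    u 4 - \<alpha> ^ 3 * t * u 0 - \<alpha>\<^sup>2 * t * u 1 - \<alpha>\<^sup>2 * u 2 - \<alpha> * u 3,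
    u 5 - \<alpha> ^ 3 * t\<^sup>2 * u 0 - t * u 4,
    u 6 + \<alpha> ^ 4 * t\<^sup>2 * u 0 - \<alpha> ^ 3 * t\<^sup>2 * u 1 + \<alpha> ^ 3 * t * u 2 + \<alpha> * t * u 4 - \<alpha> * u 5]"

context
  assumes three: "(3::'a::comm_ring_1) = 0"
begin

lemma bil_translation_matrix: "bil (translation_matrix \<beta> \<gamma> \<beta>' \<gamma>' u) (translation_matrix \<beta> \<gamma> \<beta>' \<gamma>' v) = bil u (v :: nat \<Rightarrow> 'a)"
  by (simp add: translation_matrix_def form_defs expand three residues_mod_3[OF three])

lemma tri_translation_matrix: "tri (translation_matrix \<beta> \<gamma> \<beta>' \<gamma>' u) (translation_matrix \<beta> \<gamma> \<beta>' \<gamma>' v) (translation_matrix \<beta> \<gamma> \<beta>' \<gamma>' w) = tri u v (w :: nat \<Rightarrow> 'a)"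
  by (simp add: translation_matrix_def form_defs expand three residues_mod_3[OF three])

lemma bil_shear_matrix: "bil (shear_matrix \<alpha> t u) (shear_matrix \<alpha> t v) = bil u (v :: nat \<Rightarrow> 'a)"
  by (simp add: shear_matrix_def form_defs expand three residues_mod_3[OF three])

lemma tri_shear_matrix: "tri (shear_matrix \<alpha> t u) (shear_matrix \<alpha> t v) (shear_matrix \<alpha> t w) = tri u v (w :: nat \<Rightarrow> 'a)"
  by (simp add: shear_matrix_def form_defs expand three residues_mod_3[OF three])

lemma lam_translation_matrix:
  fixes a b c A B C :: 'a
  defines "u \<equiv> (!) [1, a, b, c, lam1_poly a b c A B C, lam2_poly a b c A B C, lam3_poly a b c A B C]"
  shows "lam1_poly a (b + \<beta>) (c + \<gamma> + \<beta> * a) A (B + \<beta>') (C + \<gamma>' + \<beta>' * A) = translation_matrix \<beta> \<gamma> \<beta>' \<gamma>' u 4"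
    "lam2_poly a (b + \<beta>) (c + \<gamma> + \<beta> * a) A (B + \<beta>') (C + \<gamma>' + \<beta>' * A) = translation_matrix \<beta> \<gamma> \<beta>' \<gamma>' u 5"
    "lam3_poly a (b + \<beta>) (c + \<gamma> + \<beta> * a) A (B + \<beta>') (C + \<gamma>' + \<beta>' * A) = translation_matrix \<beta> \<gamma> \<beta>' \<gamma>' u 6"
  unfolding u_def by (simp_all add: translation_matrix_def lam1_poly_def lam2_poly_def lam3_poly_def expand three residues_mod_3[OF three])

lemma lam_shear_matrix:
  fixes a b c A B C :: 'a
  defines "u \<equiv> (!) [1, a, b, c, lam1_poly a b c A B C, lam2_poly a b c A B C, lam3_poly a b c A B C]"
  shows "lam1_poly (a + \<alpha>) (b + t * a) (c - \<alpha> * b - t * \<alpha> * a) (A + t) (B + \<alpha> ^ 3 * A) (C - t * B - \<alpha> ^ 3 * t * A) = shear_matrix \<alpha> t u 4"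
    "lam2_poly (a + \<alpha>) (b + t * a) (c - \<alpha> * b - t * \<alpha> * a) (A + t) (B + \<alpha> ^ 3 * A) (C - t * B - \<alpha> ^ 3 * t * A) = shear_matrix \<alpha> t u 5"
    "lam3_poly (a + \<alpha>) (b + t * a) (c - \<alpha> * b - t * \<alpha> * a) (A + t) (B + \<alpha> ^ 3 * A) (C - t * B - \<alpha> ^ 3 * t * A) = shear_matrix \<alpha> t u 6"
  unfolding u_def by (simp_all add: shear_matrix_def lam1_poly_def lam2_poly_def lam3_poly_def expand three residues_mod_3[OF three])

end

section \<open>The field and its twisted powers\<close>

locale ree_field =
  fixes e q :: nat and F :: "'a::finite_field itself"
  assumes q_def: "q = 3 ^ (2 * e + 1)" and card_F: "CARD('a) = q"
begin

lemma CHAR_3: "CHAR('a) = 3"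
proof -
  have "CHAR('a) dvd 3 ^ (2 * e + 1)"
    using CHAR_dvd_CARD[where 'a='a] by (simp add: card_F q_def)
  moreover have "prime (CHAR('a))"
    using CHAR_pos[where 'a='a] prime_CHAR_semidom by blast
  ultimately have "CHAR('a) dvd 3"
    using prime_dvd_power by blast
  then show ?thesis
    using \<open>prime (CHAR('a))\<close> by (simp add: primes_dvd_imp_eq)
qed

lemma three: "(3::'a) = 0"
proof -
  have "of_nat 3 = (0::'a)"
    unfolding CHAR_3[symmetric] by (rule of_nat_CHAR)
  then show ?thesis by simp
qed

lemmas ring_3 = expand three residues_mod_3[OF three]

definition s :: "'a \<Rightarrow> 'a" where "s x = x ^ \<sigma> e"

lemma s_add: "s (x + y) = s x + s y"
  using freshmans_dream'[where 'a='a and n="e + 1" and x=x and y=y] 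
  by (simp add: s_def \<sigma>_def CHAR_3)

lemma s_mult: "s (x * y) = s x * s y"
  by (simp add: s_def power_mult_distrib)

lemma s_0 [simp]: "s 0 = 0" and s_1 [simp]: "s 1 = 1"
  by (simp_all add: s_def \<sigma>_def)

lemma s_minus: "s (- x) = - s x"
  using s_add[of x "-x"] by (simp add: add_eq_0_iff)

lemma s_diff: "s (x - y) = s x - s y"
  using s_add[of x "-y"] by (simp add: s_minus)

lemma s_power: "s (x ^ n) = s x ^ n"
  by (simp add: s_def power_mult[symmetric] mult.commute)

lemma s_divide: "s (x / y) = s x / s y"
  by (simp add: s_def power_divide)

text \<open>
  The exponents multiply to \<open>3 ^ (2 * e + 2) = q * 3\<close>, and the power with exponent
  \<open>q\<close> is the identity.
\<close>

lemma s_s: "s (s x) = x ^ 3"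
proof -
  have "(3::nat) ^ (e + 1) * 3 ^ (e + 1) = q * 3"
    unfolding q_def power_add[symmetric] by (simp flip: power_add power_Suc2)
  then have "s (s x) = (x ^ CARD('a)) ^ 3"
    by (simp only: s_def \<sigma>_def card_F power_mult[symmetric])
  then show ?thesis by (simp add: finite_field_power_card_eq_same)
qed

lemma s_eq_0 [simp]: "s x = 0 \<longleftrightarrow> x = 0"
  by (simp add: s_def \<sigma>_def)

lemmas s_simps = s_add s_diff s_minus s_mult s_power s_s s_divide

lemma power_sigma:
  fixes x :: 'a
  shows "x ^ \<sigma> e = s x" "x ^ (\<sigma> e + n) = s x * x ^ n" "x ^ (2 * \<sigma> e + n) = s x ^ 2 * x ^ n"
  by (simp_all add: s_def power_add power_mult mult.commute[of 2])

lemma lam1: "lam1 e a b c = a^2 * b - a * c + s b - a ^ 3 * s a"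
  and lam2: "lam2 e a b c = s a * s b - s c + a * b^2 + b * c - s a ^ 2 * a ^ 3"
  and lam3: "lam3 e a b c = a * s c - a * s a * s b + a ^ 3 * s a * b + a^2 * b^2 - b * s b - c^2
     + s a ^ 2 * a ^ 4"
  unfolding lam1_def lam2_def lam3_def power_sigma by simp_all

lemma quadric: "lam3 e a b (c::'a) + a * lam2 e a b c + b * lam1 e a b c + c^2 = 0"
  unfolding lam1 lam2 lam3 by (simp add: ring_3 power4_eq_xxxx)

context
  fixes a b c l1 l2 l3 M N U5 U6 W5 W6 :: 'a
  assumes l: "l1 = lam1 e a b c" "l2 = lam2 e a b c" "l3 = lam3 e a b c"
    and MN: "M = l1 - a^2 * b + a * c" "N = a * b^2 + b * c - l2"
    and U: "U5 = M * N + a ^ 3 * b ^ 3 - c ^ 3" "U6 = - (N^2) - M * b ^ 3"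
    and W: "W5 = a ^ 3 * N - M^2" "W6 = c ^ 3 + a ^ 3 * b ^ 3 + M * N"
begin

lemma l3: "l3 = - (c^2 + a * l2 + b * l1)"
  using quadric[of a b c] unfolding l by (simp add: algebra_simps eq_neg_iff_add_eq_0)

lemma s_b: "s b = M + s a * a ^ 3"
  unfolding MN l lam1 by simp

lemma s_c: "s c = N + s a * M"
  unfolding MN l lam1 lam2 by (simp add: ring_3)

lemma s_l1: "s l1 = b ^ 3 + s a * (- N)"
proof -
  have "s l1 = s a ^ 2 * s b - s a * s c + b ^ 3 - s a ^ 3 * a ^ 3"
    by (simp add: l(1) lam1 s_simps)
  then show ?thesis
    unfolding s_b s_c by (simp add: ring_3)
qed

lemma s_l2: "s l2 = U5 + s a * W5"
proof -
  have "s l2 = a ^ 3 * b ^ 3 - c ^ 3 + s a * s b ^ 2 + s b * s c - (a ^ 3) ^ 2 * s a ^ 3"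
    by (simp add: l(2) lam2 s_simps)
  then show ?thesis
    unfolding U W s_b s_c by (simp add: ring_3)
qed

lemma s_l3: "s l3 = U6 + s a * W6"
proof -
  have "s l3 = - (s c ^ 2 + s a * s l2 + s b * s l1)"
    by (simp add: l3 s_simps)
  then show ?thesis
    unfolding s_b s_c s_l1 s_l2 twisted_lam3[OF three l3 MN U W] .
qed

lemma reversed_lam1: "s l3 * (l3^2 * b - l2^2 * l1 + l2 * l3 * c) = l3 ^ 3 * s l1 - l2 ^ 3 * s l2"
  unfolding s_l1 s_l2 s_l3 by (rule reversed_lam1_poly[OF three l3 MN U W])

lemma reversed_lam2:
  "s l3 * (a * l3^2 - l1^2 * l2 - c * l1 * l3) =
    (b * l3^2 - l1 * l2^2 + c * l2 * l3) * s l2 - l3 ^ 3 * s c"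
  unfolding s_c s_l2 s_l3 by (rule reversed_lam2_poly[OF three l3 MN U W])

lemma lam1_vanishes: 
  assumes "l3 = 0" "l2 = 0"
  shows "l1 = 0"
proof -
  have "l1 ^ 3 * s l1 = b * c * l1 * s l2"
    unfolding s_l1 s_l2 by (rule lam1_vanishing_poly[OF three l3 MN U W assms])
  then show ?thesis
    using assms by simp
qed

end

text \<open>
  If \<open>\<lambda>\<^sub>3 = 0\<close>, the reversed equation of
  \<open>\<lambda>\<^sub>1\<close> forces \<open>\<lambda>\<^sub>2 = 0\<close>, then
  \<open>lam1_vanishes\<close> gives \<open>\<lambda>\<^sub>1 = 0\<close>, and the quadric gives
  \<open>c = 0\<close>. The equations \<open>\<lambda>\<^sub>1 = \<lambda>\<^sub>2 = 0\<close>
  that remain for \<open>a\<close> and \<open>b\<close> are solved by hand.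
\<close>

lemma lam3_eq_0_iff: "lam3 e a b (c::'a) = 0 \<longleftrightarrow> a = 0 \<and> b = 0 \<and> c = 0"
proof
  assume 3: "lam3 e a b c = 0"
  have 2: "lam2 e a b c = 0"
    using reversed_lam1[OF refl refl refl refl refl refl refl refl refl, of a b c] 3 by simp
  have 1: "lam1 e a b c = 0"
    using lam1_vanishes[OF refl refl refl refl refl refl refl refl refl, of a b c] 3 2 by simp
  have c: "c = 0" using quadric[of a b c] 1 2 3 by simp
  have sb: "s b = a ^ 3 * s a - a^2 * b" using 1 c by (simp add: lam1 algebra_simps)
  have "0 = lam2 e a b c" using 2 by simp
  also have "\<dots> = a * b * (b - a * s a)"
    unfolding lam2 sb c by (simp add: expand)
  finally consider "a = 0" | "b = 0" | "b = a * s a" by auto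
  then have "a = 0 \<and> b = 0"
  proof cases
    case 3
    then have "s b = s a * a ^ 3" by (simp add: s_simps)
    then show ?thesis using sb 3 by auto
  qed (use sb in auto)
  then show "a = 0 \<and> b = 0 \<and> c = 0" using c by simp
qed (simp add: lam3 power2_eq_square)

text \<open>
  The image of a point under \<open>w\<close> satisfies the three defining equations: the first
  two are \<open>reversed_lam1\<close> and \<open>reversed_lam2\<close> divided by powers of
  \<open>l3\<close> and \<open>s l3\<close>, the third follows from them because the quadric is
  invariant under reversal.
\<close>

lemma w_closed:
  assumes l: "l1 = lam1 e a b c" "l2 = lam2 e a b c" "l3 = lam3 e a b (c::'a)" and "l3 \<noteq> 0"
  shows "Aff (l2 / l3) (l1 / l3) (c / l3) (b / l3) (a / l3) (1 / l3) =
    ree_pt e (l2 / l3) (l1 / l3) (c / l3)"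
proof -
  have "s l3 \<noteq> 0" using assms by simp
  note nz = \<open>l3 \<noteq> 0\<close> this
  have 1: "b / l3 = lam1 e (l2 / l3) (l1 / l3) (c / l3)"
  proof -
    have "s l3 * l3 ^ 3 * lam1 e (l2 / l3) (l1 / l3) (c / l3) =
       s l3 * (l2^2 * l1 - l2 * l3 * c) + (l3 ^ 3 * s l1 - l2 ^ 3 * s l2)"
      unfolding lam1 s_divide using nz by (simp add: field_simps power2_eq_square power3_eq_cube)
    also have "\<dots> = s l3 * l3 ^ 3 * (b / l3)"
      unfolding reversed_lam1[OF l refl refl refl refl refl refl, symmetric] using nz
      by (simp add: field_simps power2_eq_square power3_eq_cube)
    finally show ?thesis using nz by (simp only: mult_left_cancel mult_eq_0_iff power_eq_0_iff simp_thms)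
  qed
  have 2: "a / l3 = lam2 e (l2 / l3) (l1 / l3) (c / l3)"
  proof -
    define K where "K = l3^2 * b - l2^2 * l1 + l2 * l3 * c"
    have K: "s l3 * K = l3 ^ 3 * s l1 - l2 ^ 3 * s l2"
      unfolding K_def by (rule reversed_lam1[OF l refl refl refl refl refl refl])
    have "s l3 * (a * l3^2 - l1^2 * l2 - c * l1 * l3) = K * s l2 - l3 ^ 3 * s c"
      unfolding reversed_lam2[OF l refl refl refl refl refl refl] K_def by (simp add: algebra_simps)
    then have "s l3 * (s l3 * (a * l3^2 - l1^2 * l2 - c * l1 * l3)) = s l3 * (K * s l2 - l3 ^ 3 * s c)"
      by (simp only:)
    also have "\<dots> = (s l3 * K) * s l2 - s l3 * (l3 ^ 3 * s c)"
      by (simp add: algebra_simps)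
    finally have K2: "s l3 * (s l3 * (a * l3^2)) = s l3 * (s l3 * (l1^2 * l2 + c * l1 * l3)) +
        (l3 ^ 3 * s l1 - l2 ^ 3 * s l2) * s l2 - s l3 * (l3 ^ 3 * s c)"
      unfolding K by (simp add: algebra_simps)
    have "s l3 * (s l3 * l3 ^ 3) * lam2 e (l2 / l3) (l1 / l3) (c / l3) =
        s l3 * (s l3 * (l1^2 * l2 + c * l1 * l3)) +
        (l3 ^ 3 * s l1 - l2 ^ 3 * s l2) * s l2 - s l3 * (l3 ^ 3 * s c)"
      unfolding lam2 s_divide using nz by (simp add: field_simps power2_eq_square power3_eq_cube)
    also have "\<dots> = s l3 * (s l3 * l3 ^ 3) * (a / l3)"
      unfolding K2[symmetric] using nz
      by (simp add: field_simps power2_eq_square power3_eq_cube)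
    finally show ?thesis using nz by (simp only: mult_left_cancel mult_eq_0_iff power_eq_0_iff simp_thms)
  qed
  have 3: "1 / l3 = lam3 e (l2 / l3) (l1 / l3) (c / l3)"
  proof -
    have "lam3 e (l2 / l3) (l1 / l3) (c / l3) = - (l2 / l3 * (a / l3) + l1 / l3 * (b / l3) + (c / l3)^2)"
      using quadric[of "l2 / l3" "l1 / l3" "c / l3"] unfolding 1[symmetric] 2[symmetric]
      by (simp add: algebra_simps eq_neg_iff_add_eq_0)
    also have "\<dots> = - (c^2 + a * l2 + b * l1) / l3^2"
      using nz by (simp add: field_simps power2_eq_square)
    also have "\<dots> = l3 / l3^2"
      using l3[OF l refl refl refl refl refl refl] by simp
    finally show ?thesis using nz by (simp add: power2_eq_square)
  qed
  show ?thesis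
    unfolding ree_pt_def 1[symmetric] 2[symmetric] 3[symmetric] ..
qed

section \<open>Points and generators of the Ree group\<close>

abbreviation V :: "'a ree_point set" where "V \<equiv> ree_points e"
abbreviation pt :: "'a \<Rightarrow> 'a \<Rightarrow> 'a \<Rightarrow> 'a ree_point" where "pt \<equiv> ree_pt e"

lemma pt_eq_iff [simp]: "pt a b c = pt a' b' c' \<longleftrightarrow> a = a' \<and> b = b' \<and> c = c'"
  by (auto simp: ree_pt_def)

lemma pt_neq_Infty [simp]: "pt a b c \<noteq> Infty" "Infty \<noteq> pt a b c"
  by (simp_all add: ree_pt_def)

lemma pt_in_V [simp]: "pt a b c \<in> V" and Infty_in_V [simp]: "Infty \<in> V"
  by (auto simp: ree_points_def)

lemma origin_eq: "origin = pt 0 0 0"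
  by (simp add: origin_def ree_pt_def lam1 lam2 lam3)

lemma V_cases:
  assumes "x \<in> V"
  obtains "x = Infty" | a b c where "x = pt a b c"
  using assms by (auto simp: ree_points_def)

lemma V_eq: "V = insert Infty (range (\<lambda>(a, b, c). pt a b c))"
proof
  show "V \<subseteq> insert Infty (range (\<lambda>(a, b, c). pt a b c))"
  proof
    fix x assume "x \<in> V"
    then show "x \<in> insert Infty (range (\<lambda>(a, b, c). pt a b c))"
    proof (cases rule: V_cases)
      case (2 a b c)
      then show ?thesis by (auto intro: rev_image_eqI[of "(a, b, c)"])
    qed simp
  qed
qed auto

lemma finite_V: "finite V"
  by (simp add: V_eq)

lemma card_V: "card V = q ^ 3 + 1"
proof -
  have "card (range (\<lambda>(a, b, c). pt a b c)) = CARD('a \<times> 'a \<times> 'a)"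
    by (rule card_image) (auto simp: inj_on_def)
  also have "\<dots> = q ^ 3"
    by (simp add: card_F power3_eq_cube)
  finally show ?thesis
    unfolding V_eq by (subst card_insert_disjoint) auto
qed

lemma q_ge_3: "q \<ge> 3"
  by (simp add: q_def)

lemma case_pt: "(case pt a b c of Infty \<Rightarrow> x | Aff a b c l1 l2 l3 \<Rightarrow> h a b c l1 l2 l3) =
    h a b c (lam1 e a b c) (lam2 e a b c) (lam3 e a b c)"
  by (simp add: ree_pt_def)

lemma t_pt: "ree_t e \<alpha> \<beta> \<gamma> (pt a b c) =
    pt (a + \<alpha>) (b + \<beta> + s \<alpha> * a) (c + \<gamma> - \<alpha> * b + \<beta> * a - s \<alpha> * \<alpha> * a)"
  and t_Infty: "ree_t e \<alpha> \<beta> \<gamma> Infty = Infty"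
  by (simp_all add: ree_t_def case_pt power_sigma)

lemma n_pt: "ree_n e \<kappa> (pt a b c) = pt (\<kappa> * a) (s \<kappa> * \<kappa> * b) (s \<kappa> * \<kappa>\<^sup>2 * c)"
  and n_Infty: "ree_n e \<kappa> Infty = Infty"
proof -
  have \<kappa>: "\<kappa> ^ (\<sigma> e + 1) = s \<kappa> * \<kappa>"
    using power_sigma(2)[of \<kappa> 1] by (simp only: power_one_right)
  then show "ree_n e \<kappa> (pt a b c) = pt (\<kappa> * a) (s \<kappa> * \<kappa> * b) (s \<kappa> * \<kappa>\<^sup>2 * c)"
    by (simp only: ree_n_def restrict_apply pt_in_V if_True case_pt power_sigma(2)[of \<kappa> 2] \<kappa>)
qed (simp add: ree_n_def)

lemma w_Infty: "ree_w e Infty = pt 0 0 0" and w_origin: "ree_w e (pt 0 0 0) = Infty"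
  by (simp_all add: ree_w_def case_pt origin_eq)

text \<open>
  The last three equations say that applying the formula of \<open>w\<close> once more returns to
  \<open>pt a b c\<close>.
\<close>

lemma w_pt:
  assumes "pt a b c \<noteq> pt 0 0 0"
  shows "ree_w e (pt a b c) =
    pt (lam2 e a b c / lam3 e a b c) (lam1 e a b c / lam3 e a b c) (c / lam3 e a b c)"
    and "lam1 e (lam2 e a b c / lam3 e a b c) (lam1 e a b c / lam3 e a b c) (c / lam3 e a b c) = b / lam3 e a b c"
    and "lam2 e (lam2 e a b c / lam3 e a b c) (lam1 e a b c / lam3 e a b c) (c / lam3 e a b c) = a / lam3 e a b c"
    and "lam3 e (lam2 e a b c / lam3 e a b c) (lam1 e a b c / lam3 e a b c) (c / lam3 e a b c) = 1 / lam3 e a b c"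
proof -
  have "lam3 e a b c \<noteq> 0"
    using assms lam3_eq_0_iff by simp
  note w = w_closed[OF refl refl refl this]
  then show "lam1 e (lam2 e a b c / lam3 e a b c) (lam1 e a b c / lam3 e a b c) (c / lam3 e a b c) = b / lam3 e a b c"
    "lam2 e (lam2 e a b c / lam3 e a b c) (lam1 e a b c / lam3 e a b c) (c / lam3 e a b c) = a / lam3 e a b c"
    "lam3 e (lam2 e a b c / lam3 e a b c) (lam1 e a b c / lam3 e a b c) (c / lam3 e a b c) = 1 / lam3 e a b c"
    by (simp_all add: ree_pt_def)
  show "ree_w e (pt a b c) =
    pt (lam2 e a b c / lam3 e a b c) (lam1 e a b c / lam3 e a b c) (c / lam3 e a b c)"
    using assms w by (simp add: ree_w_def case_pt origin_eq)
qed

lemma w_w: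
  assumes "x \<in> V"
  shows "ree_w e x \<in> V" "ree_w e (ree_w e x) = x"
proof -
  have "ree_w e x \<in> V \<and> ree_w e (ree_w e x) = x"
    using assms
  proof (cases rule: V_cases)
    case (2 a b c)
    show ?thesis
    proof (cases "pt a b c = pt 0 0 0")
      case False
      define l where "l = lam3 e a b c"
      have l: "l \<noteq> 0" using False lam3_eq_0_iff by (simp add: l_def)
      note w = w_pt[OF False, folded l_def]
      have "lam3 e (lam2 e a b c / l) (lam1 e a b c / l) (c / l) \<noteq> 0"
        using l by (simp add: w(4))
      then have nz: "pt (lam2 e a b c / l) (lam1 e a b c / l) (c / l) \<noteq> pt 0 0 0"
        using lam3_eq_0_iff by simp
      show ?thesis
        unfolding 2 w(1) w_pt(1)[OF nz] w(2-4) using l by simp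
    qed (use 2 in \<open>simp add: w_origin w_Infty\<close>)
  qed (simp add: w_origin w_Infty)
  then show "ree_w e x \<in> V" "ree_w e (ree_w e x) = x" by simp_all
qed

lemma BijI:
  assumes "h \<in> extensional V" "\<And>x. x \<in> V \<Longrightarrow> h x \<in> V" "inj_on h V"
  shows "h \<in> Bij V"
  using assms endo_inj_surj[OF finite_V, of h] by (auto simp: Bij_def bij_betw_def)

lemma w_Bij: "ree_w e \<in> Bij V"
proof (rule BijI)
  show "ree_w e \<in> extensional V" by (simp add: ree_w_def)
  show "inj_on (ree_w e) V" by (rule inj_on_inverseI[of V "ree_w e"]) (rule w_w(2))
qed (rule w_w(1))

lemma t_Bij: "ree_t e \<alpha> \<beta> \<gamma> \<in> Bij V"
proof (rule BijI)
  show "ree_t e \<alpha> \<beta> \<gamma> \<in> extensional V" by (simp add: ree_t_def)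
  show "ree_t e \<alpha> \<beta> \<gamma> x \<in> V" if "x \<in> V" for x
    using that by (cases rule: V_cases) (simp_all add: t_pt t_Infty)
  show "inj_on (ree_t e \<alpha> \<beta> \<gamma>) V"
    by (rule inj_onI) (auto simp: t_pt t_Infty elim!: V_cases)
qed

lemma n_Bij: "\<kappa> \<noteq> 0 \<Longrightarrow> ree_n e \<kappa> \<in> Bij V"
proof (rule BijI)
  show "ree_n e \<kappa> \<in> extensional V" by (simp add: ree_n_def)
  show "ree_n e \<kappa> x \<in> V" if "x \<in> V" for x
    using that by (cases rule: V_cases) (simp_all add: n_pt n_Infty)
  show "inj_on (ree_n e \<kappa>) V" if "\<kappa> \<noteq> 0"
    using that by (intro inj_onI) (auto simp: n_pt n_Infty elim!: V_cases)
qed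

section \<open>Similitudes\<close>

definition coords :: "'a ree_point \<Rightarrow> nat \<Rightarrow> 'a" where
  "coords x = (case x of Infty \<Rightarrow> (!) [0, 0, 0, 0, 0, 0, 1]
    | Aff a b c l1 l2 l3 \<Rightarrow> (!) [1, a, b, c, l1, l2, l3])"

text \<open>
  The factors \<open>\<mu> x\<close> are needed because \<open>coords x\<close> is one of many
  vectors that represent the point \<open>x\<close>. The same \<open>\<mu>\<close> serves both
  forms; this rules out scalar ambiguities later.
\<close>

definition similitude :: "('a ree_point \<Rightarrow> 'a ree_point) \<Rightarrow> bool" where
  "similitude g \<longleftrightarrow> (\<exists>\<mu>. (\<forall>x\<in>V. \<mu> x \<noteq> 0) \<and>
    (\<forall>x\<in>V. \<forall>y\<in>V. bil (coords (g x)) (coords (g y)) = \<mu> x * \<mu> y * bil (coords x) (coords y)) \<and>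
    (\<forall>x\<in>V. \<forall>y\<in>V. \<forall>z\<in>V. tri (coords (g x)) (coords (g y)) (coords (g z)) =
       \<mu> x * \<mu> y * \<mu> z * tri (coords x) (coords y) (coords z)))"

lemma similitudeI:
  assumes "\<And>x. x \<in> V \<Longrightarrow> \<mu> x \<noteq> 0"
    and M: "\<And>x. x \<in> V \<Longrightarrow> \<forall>i<7. coords (g x) i = \<mu> x * M (coords x) i"
    and "\<And>u v. bil (M u) (M v) = bil u v" "\<And>u v w. tri (M u) (M v) (M w) = tri u v w"
  shows "similitude g"
  unfolding similitude_def
proof (intro exI[of _ \<mu>] conjI ballI)
  fix x y z assume V: "x \<in> V" "y \<in> V" "z \<in> V"
  show "tri (coords (g x)) (coords (g y)) (coords (g z)) = \<mu> x * \<mu> y * \<mu> z * tri (coords x) (coords y) (coords z)"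
    unfolding tri_scale[OF M[OF V(1)] M[OF V(2)] M[OF V(3)]] assms(4) ..
next
  fix x y assume V: "x \<in> V" "y \<in> V"
  show "bil (coords (g x)) (coords (g y)) = \<mu> x * \<mu> y * bil (coords x) (coords y)"
    unfolding bil_scale[OF M[OF V(1)] M[OF V(2)]] assms(3) ..
qed (rule assms(1))

lemma lam_eq_poly: "lam1 e a b c = lam1_poly a b c (s a) (s b) (s c)" "lam2 e a b c = lam2_poly a b c (s a) (s b) (s c)"
    "lam3 e a b (c::'a) = lam3_poly a b c (s a) (s b) (s c)"
  by (simp_all add: lam1 lam2 lam3 lam1_poly_def lam2_poly_def lam3_poly_def)

lemma coords_Infty: "coords Infty = (!) [0, 0, 0, 0, 0, 0, 1]"
  by (simp add: coords_def)

lemma coords_pt: "coords (pt a b c) = (!) [1, a, b, c, lam1 e a b c, lam2 e a b c, lam3 e a b c]"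
  by (simp add: coords_def case_pt)

lemma similitude_t_0: "similitude (ree_t e 0 \<beta> \<gamma>)"
proof (rule similitudeI[where \<mu> = "\<lambda>_. 1" and M = "translation_matrix \<beta> \<gamma> (s \<beta>) (s \<gamma>)"])
  show "\<forall>i<7. coords (ree_t e 0 \<beta> \<gamma> x) i = 1 * translation_matrix \<beta> \<gamma> (s \<beta>) (s \<gamma>) (coords x) i" if "x \<in> V" for x
    using that
  proof (cases rule: V_cases)
    case 1
    then show ?thesis by (simp add: all_less_7 t_Infty coords_Infty translation_matrix_def)
  next
    case (2 a b c)
    define M where "M = translation_matrix \<beta> \<gamma> (s \<beta>) (s \<gamma>) (coords (pt a b c))"
    have "lam1 e a (b + \<beta>) (c + \<gamma> + \<beta> * a) = M 4" "lam2 e a (b + \<beta>) (c + \<gamma> + \<beta> * a) = M 5"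
      "lam3 e a (b + \<beta>) (c + \<gamma> + \<beta> * a) = M 6"
      unfolding M_def coords_pt lam_eq_poly s_add s_mult by (rule lam_translation_matrix[OF three])+
    moreover have "M 0 = 1" "M 1 = a" "M 2 = b + \<beta>" "M 3 = c + \<gamma> + \<beta> * a"
      by (simp_all add: M_def translation_matrix_def coords_pt)
    moreover have "ree_t e 0 \<beta> \<gamma> x = pt a (b + \<beta>) (c + \<gamma> + \<beta> * a)"
      by (simp add: 2 t_pt)
    ultimately show ?thesis
      unfolding 2 M_def[symmetric] all_less_7 by (simp add: coords_pt)
  qed
qed (simp_all add: bil_translation_matrix[OF three] tri_translation_matrix[OF three])

lemma similitude_t_1: "similitude (ree_t e \<alpha> 0 0)"
proof (rule similitudeI[where \<mu> = "\<lambda>_. 1" and M = "shear_matrix \<alpha> (s \<alpha>)"])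
  show "\<forall>i<7. coords (ree_t e \<alpha> 0 0 x) i = 1 * shear_matrix \<alpha> (s \<alpha>) (coords x) i" if "x \<in> V" for x
    using that
  proof (cases rule: V_cases)
    case 1
    then show ?thesis by (simp add: all_less_7 t_Infty coords_Infty shear_matrix_def)
  next
    case (2 a b c)
    define M where "M = shear_matrix \<alpha> (s \<alpha>) (coords (pt a b c))"
    define a' b' c' where "a' = a + \<alpha>" and "b' = b + s \<alpha> * a" and "c' = c - \<alpha> * b - s \<alpha> * \<alpha> * a"
    have "s c' = s c - s \<alpha> * s b - \<alpha> ^ 3 * s \<alpha> * s a"
      unfolding c'_def by (simp add: s_simps)
    moreover have "s b' = s b + \<alpha> ^ 3 * s a" "s a' = s a + s \<alpha>"
      unfolding b'_def a'_def by (simp_all add: s_simps)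
    ultimately have "lam1 e a' b' c' = M 4" "lam2 e a' b' c' = M 5" "lam3 e a' b' c' = M 6"
      unfolding M_def coords_pt lam_eq_poly
      using lam_shear_matrix[OF three, where \<alpha> = \<alpha> and t = "s \<alpha>" and a = a and b = b and c = c and A = "s a" and B = "s b" and C = "s c"]
      by (simp_all only: a'_def b'_def c'_def)
    moreover have "M 0 = 1" "M 1 = a'" "M 2 = b'" "M 3 = c'"
      by (simp_all add: M_def shear_matrix_def coords_pt a'_def b'_def c'_def)
    moreover have "ree_t e \<alpha> 0 0 x = pt a' b' c'"
      by (simp add: 2 t_pt a'_def b'_def c'_def)
    ultimately show ?thesis
      unfolding 2 M_def[symmetric] all_less_7 by (simp add: coords_pt)
  qed
qed (simp_all add: bil_shear_matrix[OF three] tri_shear_matrix[OF three])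

text \<open>
  The diagonal matrix with entries \<open>1\<close>, \<open>\<kappa>\<close>,
  \<open>t * \<kappa>\<close>, \<open>t * \<kappa>\<^sup>2\<close>, \<dots> is divided by its
  middle entry \<open>\<nu>\<close>; after that, opposite entries have product \<open>1\<close>
  and both forms are preserved exactly.
\<close>

lemma similitude_n:
  assumes "\<kappa> \<noteq> 0"
  shows "similitude (ree_n e \<kappa>)"
proof -
  define t where "t = s \<kappa>"
  have nz: "\<kappa> \<noteq> 0" "t \<noteq> 0" using assms by (simp_all add: t_def)
  define \<nu> where "\<nu> = t * \<kappa>\<^sup>2"
  define M :: "(nat \<Rightarrow> 'a) \<Rightarrow> nat \<Rightarrow> 'a" where
    "M = (\<lambda>u. (!) [u 0 / \<nu>, \<kappa> * u 1 / \<nu>, t * \<kappa> * u 2 / \<nu>, u 3, \<kappa> * u 4, t * \<kappa> * u 5, t * \<kappa>\<^sup>2 * u 6])"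
  show ?thesis
  proof (rule similitudeI[where \<mu> = "\<lambda>x. if x = Infty then inverse \<nu> else \<nu>" and M = M])
    show "(if x = Infty then inverse \<nu> else \<nu>) \<noteq> 0" for x :: "'a ree_point"
      using nz by (simp add: \<nu>_def)
    show "\<forall>i<7. coords (ree_n e \<kappa> x) i = (if x = Infty then inverse \<nu> else \<nu>) * M (coords x) i" if "x \<in> V" for x
      using that
    proof (cases rule: V_cases)
      case 1
      then show ?thesis
        unfolding 1 n_Infty coords_Infty all_less_7 M_def using nz by (simp add: \<nu>_def field_simps)
    next
      case (2 a b c)
      have "lam1 e (\<kappa> * a) (t * \<kappa> * b) (t * \<kappa>\<^sup>2 * c) = \<nu> * (\<kappa> * lam1 e a b c)"
        "lam2 e (\<kappa> * a) (t * \<kappa> * b) (t * \<kappa>\<^sup>2 * c) = \<nu> * (t * \<kappa> * lam2 e a b c)"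
        "lam3 e (\<kappa> * a) (t * \<kappa> * b) (t * \<kappa>\<^sup>2 * c) = \<nu> * (t * \<kappa>\<^sup>2 * lam3 e a b c)"
        unfolding lam1 lam2 lam3 \<nu>_def by (simp_all add: s_simps flip: t_def) (simp_all add: t_def s_s expand)
      then show ?thesis
        unfolding 2 n_pt all_less_7 t_def[symmetric] coords_pt M_def using nz by (simp add: \<nu>_def)
    qed
    show "bil (M u) (M v) = bil u v" for u v
      using nz by (simp add: M_def bil_def \<nu>_def field_simps power2_eq_square)
    show "tri (M u) (M v) (M w) = tri u v w" for u v w
      using nz by (simp add: M_def tri_def minor_def \<nu>_def field_simps power2_eq_square)
  qed
qed

text \<open>
  Reversal changes the sign of \<open>tri\<close>, so its negative is the isometry of both forms.
\<close>

lemma similitude_w: "similitude (ree_w e)"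
proof -
  define M :: "(nat \<Rightarrow> 'a) \<Rightarrow> nat \<Rightarrow> 'a" where "M = (\<lambda>u i. - u (6 - i))"
  define \<mu> :: "'a ree_point \<Rightarrow> 'a" where
    "\<mu> x = (if x = Infty \<or> x = pt 0 0 0 then -1 else - inverse (coords x 6))" for x
  show ?thesis
  proof (rule similitudeI[where \<mu> = \<mu> and M = M])
    show "\<mu> x \<noteq> 0" if "x \<in> V" for x
      using that by (cases rule: V_cases) (auto simp: \<mu>_def coords_pt lam3_eq_0_iff)
    show "\<forall>i<7. coords (ree_w e x) i = \<mu> x * M (coords x) i" if "x \<in> V" for x
      using that
    proof (cases rule: V_cases)
      case 1
      then show ?thesis
        by (simp add: w_Infty coords_Infty coords_pt all_less_7 M_def \<mu>_def lam1 lam2 lam3)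
    next
      case (2 a b c)
      show ?thesis
      proof (cases "pt a b c = pt 0 0 0")
        case True
        then show ?thesis
          by (simp add: 2 w_origin coords_Infty coords_pt all_less_7 M_def \<mu>_def lam1 lam2 lam3)
      next
        case False
        then have "lam3 e a b c \<noteq> 0"
          by (simp add: lam3_eq_0_iff)
        moreover have "\<mu> (pt a b c) = - inverse (lam3 e a b c)"
          using False by (auto simp: \<mu>_def coords_pt)
        ultimately show ?thesis
          unfolding 2 w_pt(1)[OF False] all_less_7 coords_pt w_pt(2-4)[OF False] M_def
          by (simp add: field_simps)
      qed
    qed
    show "bil (M u) (M v) = bil u v" for u v
      by (simp add: M_def bil_def)
    show "tri (M u) (M v) (M w) = tri u v w" for u v w
      by (simp add: M_def tri_def minor_def algebra_simps)
  qed
qed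

lemma similitude_compose:
  assumes "similitude g" "similitude h" "\<And>x. x \<in> V \<Longrightarrow> h x \<in> V"
  shows "similitude (compose V g h)"
proof -
  obtain \<mu> where \<mu>: "\<forall>x\<in>V. \<mu> x \<noteq> 0"
    "\<forall>x\<in>V. \<forall>y\<in>V. bil (coords (g x)) (coords (g y)) = \<mu> x * \<mu> y * bil (coords x) (coords y)"
    "\<forall>x\<in>V. \<forall>y\<in>V. \<forall>z\<in>V. tri (coords (g x)) (coords (g y)) (coords (g z)) = \<mu> x * \<mu> y * \<mu> z * tri (coords x) (coords y) (coords z)"
    using assms(1) unfolding similitude_def by blast
  obtain \<nu> where \<nu>: "\<forall>x\<in>V. \<nu> x \<noteq> 0"
    "\<forall>x\<in>V. \<forall>y\<in>V. bil (coords (h x)) (coords (h y)) = \<nu> x * \<nu> y * bil (coords x) (coords y)"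
    "\<forall>x\<in>V. \<forall>y\<in>V. \<forall>z\<in>V. tri (coords (h x)) (coords (h y)) (coords (h z)) = \<nu> x * \<nu> y * \<nu> z * tri (coords x) (coords y) (coords z)"
    using assms(2) unfolding similitude_def by blast
  show ?thesis
    unfolding similitude_def
    by (rule exI[of _ "\<lambda>x. \<mu> (h x) * \<nu> x"]) (simp add: \<mu> \<nu> assms(3) compose_eq mult_ac)
qed

lemma similitude_inverse:
  assumes "similitude g" "\<And>x. x \<in> V \<Longrightarrow> h x \<in> V" "\<And>x. x \<in> V \<Longrightarrow> g (h x) = x"
  shows "similitude h"
proof -
  obtain \<mu> where \<mu>: "\<forall>x\<in>V. \<mu> x \<noteq> 0"
    "\<forall>x\<in>V. \<forall>y\<in>V. bil (coords (g x)) (coords (g y)) = \<mu> x * \<mu> y * bil (coords x) (coords y)"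
    "\<forall>x\<in>V. \<forall>y\<in>V. \<forall>z\<in>V. tri (coords (g x)) (coords (g y)) (coords (g z)) = \<mu> x * \<mu> y * \<mu> z * tri (coords x) (coords y) (coords z)"
    using assms(1) unfolding similitude_def by blast
  show ?thesis
    unfolding similitude_def
  proof (intro exI[of _ "\<lambda>x. inverse (\<mu> (h x))"] conjI ballI)
    show "inverse (\<mu> (h x)) \<noteq> 0" if "x \<in> V" for x
      using \<mu>(1) assms(2)[OF that] by simp
    show "bil (coords (h x)) (coords (h y)) = inverse (\<mu> (h x)) * inverse (\<mu> (h y)) * bil (coords x) (coords y)"
      if V: "x \<in> V" "y \<in> V" for x y
    proof -
      have "bil (coords x) (coords y) = \<mu> (h x) * \<mu> (h y) * bil (coords (h x)) (coords (h y))"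
        using \<mu>(2) assms(2)[OF V(1)] assms(2)[OF V(2)] assms(3)[OF V(1)] assms(3)[OF V(2)] by metis
      then show ?thesis
        using \<mu>(1) assms(2)[OF V(1)] assms(2)[OF V(2)] by (simp add: field_simps)
    qed
    show "tri (coords (h x)) (coords (h y)) (coords (h z)) =
        inverse (\<mu> (h x)) * inverse (\<mu> (h y)) * inverse (\<mu> (h z)) * tri (coords x) (coords y) (coords z)"
      if V: "x \<in> V" "y \<in> V" "z \<in> V" for x y z
    proof -
      have "tri (coords x) (coords y) (coords z) = \<mu> (h x) * \<mu> (h y) * \<mu> (h z) * tri (coords (h x)) (coords (h y)) (coords (h z))"
        using \<mu>(3) assms(2)[OF V(1)] assms(2)[OF V(2)] assms(2)[OF V(3)]
          assms(3)[OF V(1)] assms(3)[OF V(2)] assms(3)[OF V(3)] by metis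
      then show ?thesis
        using \<mu>(1) assms(2)[OF V(1)] assms(2)[OF V(2)] assms(2)[OF V(3)] by (simp add: field_simps)
    qed
  qed
qed

lemma subgroup_similitudes: "subgroup {g \<in> Bij V. similitude g} (BijGroup V)"
proof
  show "{g \<in> Bij V. similitude g} \<subseteq> carrier (BijGroup V)"
    by (auto simp: BijGroup_def)
  show "g \<otimes>\<^bsub>BijGroup V\<^esub> h \<in> {g \<in> Bij V. similitude g}"
    if "g \<in> {g \<in> Bij V. similitude g}" "h \<in> {g \<in> Bij V. similitude g}" for g h
    using that similitude_compose[of g h] Bij_imp_funcset[of h V]
    by (auto simp: BijGroup_def compose_Bij Pi_iff)
  have "similitude (\<lambda>x\<in>V. x)"
    unfolding similitude_def by (rule exI[of _ "\<lambda>_. 1"]) simp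
  then show "\<one>\<^bsub>BijGroup V\<^esub> \<in> {g \<in> Bij V. similitude g}"
    by (simp add: BijGroup_def id_Bij)
  show "inv\<^bsub>BijGroup V\<^esub> g \<in> {g \<in> Bij V. similitude g}" if "g \<in> {g \<in> Bij V. similitude g}" for g
  proof -
    have g: "g \<in> Bij V" "similitude g" using that by simp_all
    then have "g ` V = V" by (simp add: Bij_def bij_betw_def)
    then have "similitude (\<lambda>x\<in>V. inv_into V g x)"
      by (intro similitude_inverse[OF g(2)]) (simp_all add: Bij_inv_into_mem[OF g(1)] f_inv_into_f)
    then show ?thesis
      using g(1) by (simp add: inv_BijGroup restrict_inv_into_Bij)
  qed
qed

lemma t_decompose: "ree_t e \<alpha> \<beta> \<gamma> = compose V (ree_t e 0 \<beta> (\<gamma> - \<alpha> * \<beta>)) (ree_t e \<alpha> 0 0)"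
proof (rule extensionalityI[of _ V])
  show "ree_t e \<alpha> \<beta> \<gamma> x = compose V (ree_t e 0 \<beta> (\<gamma> - \<alpha> * \<beta>)) (ree_t e \<alpha> 0 0) x" if "x \<in> V" for x
    using that by (cases rule: V_cases) (simp_all add: compose_eq t_pt t_Infty algebra_simps)
qed (simp_all add: ree_t_def)

lemma ree_generators:
  "{ree_w e} \<union> {ree_t e \<alpha> \<beta> \<gamma> | \<alpha> \<beta> \<gamma>. True} \<union> {ree_n e \<kappa> | \<kappa>. \<kappa> \<noteq> 0} \<subseteq> {g \<in> Bij V. similitude g}"
proof -
  have "similitude (ree_t e \<alpha> \<beta> \<gamma>)" for \<alpha> \<beta> \<gamma>
    unfolding t_decompose[of \<alpha> \<beta> \<gamma>]
    by (intro similitude_compose similitude_t_0 similitude_t_1 funcset_mem[OF Bij_imp_funcset[OF t_Bij]])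
  then show ?thesis
    using w_Bij t_Bij n_Bij similitude_w similitude_n by blast
qed

abbreviation R :: "('a ree_point \<Rightarrow> 'a ree_point) monoid" where "R \<equiv> ree_group e"

lemma R_similitude:
  assumes "g \<in> carrier R"
  shows "g \<in> Bij V" "similitude g"
  using assms group.subgroup_generated_minimal[OF group_BijGroup subgroup_similitudes ree_generators]
  unfolding ree_group_def by auto

lemma R_generators: "ree_w e \<in> carrier R" "ree_t e \<alpha> \<beta> \<gamma> \<in> carrier R" "\<kappa> \<noteq> 0 \<Longrightarrow> ree_n e \<kappa> \<in> carrier R"
proof -
  have "{ree_w e} \<union> {ree_t e \<alpha> \<beta> \<gamma> | \<alpha> \<beta> \<gamma>. True} \<union> {ree_n e \<kappa> | \<kappa>. \<kappa> \<noteq> 0} \<subseteq> carrier R"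
    unfolding ree_group_def
    by (rule group.subgroup_generated_subset_carrier_subset[OF group_BijGroup])
      (use ree_generators in \<open>auto simp: BijGroup_def\<close>)
  then show "ree_w e \<in> carrier R" "ree_t e \<alpha> \<beta> \<gamma> \<in> carrier R" "\<kappa> \<noteq> 0 \<Longrightarrow> ree_n e \<kappa> \<in> carrier R"
    by blast+
qed

lemma permutation_group_R: "permutation_group V R"
  unfolding ree_group_def
  by (rule permutation_group.intro[OF group.subgroup_subgroup_generated[OF group_BijGroup]])

section \<open>The stabilizer of two points\<close>

lemma form_values:
  "bil (coords Infty) (coords (pt a b c)) = 1"
  "bil (coords (pt 0 0 0)) (coords (pt a b c)) = lam3 e a b c"
  "tri (coords (pt 0 0 0)) (coords Infty) (coords (pt a b c)) = - c"
  "tri (coords Infty) (coords (pt a b c)) (coords (pt a' b' c')) = c' - c + a * b' - b * a'"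
  "tri (coords (pt 0 0 0)) (coords (pt a b c)) (coords (pt a' b' c')) =
    c * lam3 e a' b' c' - lam3 e a b c * c' + lam1 e a b c * lam2 e a' b' c' - lam2 e a b c * lam1 e a' b' c'"
proof -
  have 0: "coords (pt 0 0 0) = (!) [1, 0, 0, 0, 0, 0, 0]"
    by (simp add: coords_pt lam1 lam2 lam3)
  show "bil (coords Infty) (coords (pt a b c)) = 1"
    "bil (coords (pt 0 0 0)) (coords (pt a b c)) = lam3 e a b c"
    "tri (coords (pt 0 0 0)) (coords Infty) (coords (pt a b c)) = - c"
    "tri (coords Infty) (coords (pt a b c)) (coords (pt a' b' c')) = c' - c + a * b' - b * a'"
    "tri (coords (pt 0 0 0)) (coords (pt a b c)) (coords (pt a' b' c')) =
      c * lam3 e a' b' c' - lam3 e a b c * c' + lam1 e a b c * lam2 e a' b' c' - lam2 e a b c * lam1 e a' b' c'"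
    unfolding 0 by (simp_all add: form_defs coords_Infty coords_pt)
qed

text \<open>
  The permutation need not be known to be linear. The value of \<open>tri\<close> at the origin,
  \<open>Infty\<close> and \<open>x\<close> shows that the third coordinate is multiplied by a
  constant \<open>m\<close>; its values at \<open>Infty\<close>, \<open>x\<close>,
  \<open>y\<close> show that all determinants \<open>a * b' - b * a'\<close> are multiplied by
  \<open>m\<close>, which makes the action on \<open>(a, b)\<close> linear; and those at the
  origin, \<open>x\<close>, \<open>y\<close>, with the help of \<open>bil\<close>, do the same for
  \<open>\<lambda>\<^sub>1\<close> and \<open>\<lambda>\<^sub>2\<close>. Comparing the formulas of
  \<open>\<lambda>\<^sub>1\<close> and \<open>\<lambda>\<^sub>2\<close> at a few small points then
  leaves only the maps \<open>n\<close>. Working with values at points rather than with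
  polynomials in \<open>a\<close>, \<open>b\<close>, \<open>c\<close> covers \<open>q = 3\<close>,
  where different exponents give equal functions.
\<close>

lemma stabilizer_two_points:
  assumes g: "g \<in> Bij V" "similitude g" "g Infty = Infty" "g (pt 0 0 0) = pt 0 0 0"
  obtains \<kappa> where "\<kappa> \<noteq> 0" "g = ree_n e \<kappa>"
proof -
  obtain \<mu> where \<mu>: "\<And>x. x \<in> V \<Longrightarrow> \<mu> x \<noteq> 0"
    "\<And>x y. x \<in> V \<Longrightarrow> y \<in> V \<Longrightarrow> bil (coords (g x)) (coords (g y)) = \<mu> x * \<mu> y * bil (coords x) (coords y)"
    "\<And>x y z. x \<in> V \<Longrightarrow> y \<in> V \<Longrightarrow> z \<in> V \<Longrightarrow>
      tri (coords (g x)) (coords (g y)) (coords (g z)) = \<mu> x * \<mu> y * \<mu> z * tri (coords x) (coords y) (coords z)"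
    using g(2) unfolding similitude_def by metis
  have "\<exists>a' b' c'. g (pt a b c) = pt a' b' c'" for a b c
  proof -
    have "g (pt a b c) \<in> V"
      using Bij_imp_funcset[OF g(1)] by (rule funcset_mem) simp
    moreover have "inj_on g V"
      using g(1) by (simp add: Bij_def bij_betw_def)
    then have "g (pt a b c) \<noteq> g Infty"
      by (simp add: inj_on_eq_iff)
    ultimately show ?thesis
      using g(3) by (metis V_cases)
  qed
  then obtain A B C where img: "\<And>a b c. g (pt a b c) = pt (A a b c) (B a b c) (C a b c)"
    by metis
  define m where "m = \<mu> (pt 0 0 0)"
  have m: "m \<noteq> 0" using \<mu>(1) by (simp add: m_def)
  have \<mu>_pt: "\<mu> (pt a b c) = m" and \<mu>_Infty: "\<mu> Infty * m = 1" for a b c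
  proof -
    have *: "1 = \<mu> Infty * \<mu> (pt a b c)" for a b c
      using \<mu>(2)[of Infty "pt a b c"] by (simp add: g(3) img form_values)
    then show "\<mu> Infty * m = 1" by (simp add: m_def)
    then show "\<mu> (pt a b c) = m"
      using *[of a b c] by (metis mult_cancel_left mult_zero_left zero_neq_one)
  qed
  have C: "C a b c = m * c" for a b c
  proof -
    have "- C a b c = m * \<mu> Infty * m * - c"
      using \<mu>(3)[of "pt 0 0 0" Infty "pt a b c"] unfolding \<mu>_pt g(3,4) unfolding img form_values by simp
    also have "\<dots> = (\<mu> Infty * m) * m * - c"
      by (simp only: mult_ac)
    finally show ?thesis
      unfolding \<mu>_Infty by simp
  qed
  have AB: "A a b c * B a' b' c' - B a b c * A a' b' c' = m * (a * b' - b * a')" for a b c a' b' c'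
  proof -
    have "m * c' - m * c + A a b c * B a' b' c' - B a b c * A a' b' c' =
        (\<mu> Infty * m) * m * (c' - c + a * b' - b * a')"
      using \<mu>(3)[of Infty "pt a b c" "pt a' b' c'"] unfolding \<mu>_pt g(3,4) unfolding img form_values C by simp
    then show ?thesis
      unfolding \<mu>_Infty by (simp add: algebra_simps)
  qed
  \<comment> \<open>\<open>(p, v)\<close> and \<open>(u, w)\<close> are the images of the basis vectors \<open>(1, 0)\<close> and \<open>(0, 1)\<close>.\<close>
  define p v u w where "p = A 1 0 0" and "v = B 1 0 0" and "u = A 0 1 0" and "w = B 0 1 0"
  have det: "p * w - v * u = m"
    using AB[of 1 0 0 0 1 0] by (simp add: p_def v_def u_def w_def)
  have pv: "p * B a b c - v * A a b c = m * b" and uw: "u * B a b c - w * A a b c = - (m * a)" for a b c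
    using AB[of 1 0 0 a b c] AB[of 0 1 0 a b c] by (simp_all add: p_def v_def u_def w_def)
  have A: "A a b c = p * a + u * b" for a b c
  proof -
    have "m * A a b c = u * (p * B a b c - v * A a b c) - p * (u * B a b c - w * A a b c)"
      unfolding det[symmetric] by (simp add: algebra_simps)
    also have "\<dots> = m * (p * a + u * b)"
      unfolding pv uw by (simp add: algebra_simps)
    finally show ?thesis using m by simp
  qed
  have B: "B a b c = v * a + w * b" for a b c
  proof -
    have "m * B a b c = w * (p * B a b c - v * A a b c) - v * (u * B a b c - w * A a b c)"
      unfolding det[symmetric] by (simp add: algebra_simps)
    also have "\<dots> = m * (v * a + w * b)"
      unfolding pv uw by (simp add: algebra_simps)
    finally show ?thesis using m by simp
  qed
  define l1 l2 where "l1 a b c = lam1 e (p * a + u * b) (v * a + w * b) (m * c)"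
    and "l2 a b c = lam2 e (p * a + u * b) (v * a + w * b) (m * c)" for a b c
  have img: "g (pt a b c) = pt (p * a + u * b) (v * a + w * b) (m * c)" for a b c
    unfolding img A B C ..
  have l3: "lam3 e (p * a + u * b) (v * a + w * b) (m * c) = m * m * lam3 e a b c" for a b c
    using \<mu>(2)[of "pt 0 0 0" "pt a b c"] unfolding \<mu>_pt g(3,4) unfolding img form_values by simp
  have l12: "l1 a b c * l2 a' b' c' - l2 a b c * l1 a' b' c' =
      m ^ 3 * (lam1 e a b c * lam2 e a' b' c' - lam2 e a b c * lam1 e a' b' c')" for a b c a' b' c'
    using \<mu>(3)[of "pt 0 0 0" "pt a b c" "pt a' b' c'"]
    unfolding \<mu>_pt g(3,4) unfolding img form_values l3 l1_def l2_def by (simp add: algebra_simps power3_eq_cube)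
  have sm: "s m \<noteq> 0" using m by simp
  \<comment> \<open>The point \<open>pt 0 0 1\<close> has \<open>\<lambda>\<^sub>1 = 0\<close> and \<open>\<lambda>\<^sub>2 = -1\<close>, and its image is \<open>pt 0 0 m\<close>;
    testing against it isolates \<open>\<lambda>\<^sub>1\<close>.\<close>
  define r where "r = m ^ 3 / s m"
  have r: "m ^ 3 = s m * r" "r \<noteq> 0" using m sm by (simp_all add: r_def)
  have l1: "l1 a b c = r * lam1 e a b c" for a b c
    using l12[of 0 0 1 a b c] sm by (simp add: l1_def l2_def lam1 lam2 r)
  have l2: "l2 a b c = s m * (lam2 e a b c - lam1 e a b c) - l2 1 0 0 * lam1 e a b c" for a b c
  proof -
    have "r * l2 a b c = s m * r * (lam2 e a b c - lam1 e a b c) - l2 1 0 0 * (r * lam1 e a b c)"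
      using l12[of 1 0 0 a b c] unfolding l1 r(1) by (simp add: lam1 lam2 algebra_simps)
    also have "\<dots> = r * (s m * (lam2 e a b c - lam1 e a b c) - l2 1 0 0 * lam1 e a b c)"
      by (simp add: algebra_simps)
    finally show ?thesis using r(2) by simp
  qed
  have "u * m = l1 0 1 0 - l1 0 1 1"
    by (simp add: l1_def lam1)
  also have "\<dots> = 0"
    by (simp add: l1 lam1)
  finally have u: "u = 0"
    using m by simp
  have mpw: "m = p * w" using det u by simp
  have "p * m = l1 1 0 0 - l1 1 0 1"
    by (simp add: l1_def lam1)
  also have "\<dots> = r"
    by (simp add: l1 lam1 algebra_simps)
  finally have rpm: "r = p * m" ..
  have sw: "s w = r"
    using l1[of 0 1 0] u by (simp add: l1_def lam1)
  have "p\<^sup>2 * w + s w = l1 1 1 0 - l1 1 0 0"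
    by (simp add: l1_def lam1 u s_add algebra_simps)
  also have "\<dots> = r + r"
    by (simp add: l1 lam1)
  finally have ppw: "p\<^sup>2 * w = r"
    unfolding sw by simp
  have "l2 0 1 0 = 0"
    using u by (simp add: l2_def lam2)
  then have k: "l2 1 0 0 = - s m"
    using l2[of 0 1 0] by (simp add: lam1 lam2 algebra_simps eq_neg_iff_add_eq_0)
  have l2: "l2 a b c = s m * lam2 e a b c" for a b c
    using l2[of a b c] unfolding k by (simp add: algebra_simps)
  have "v * m - s m = l2 1 0 1 - l2 1 0 0"
    by (simp add: l2_def lam2)
  also have "\<dots> = - s m"
    by (simp add: l2 lam2 algebra_simps)
  finally have v: "v = 0"
    using m by simp
  have "p ^ 3 * s p = r"
    using l1[of 1 0 0] v by (simp add: l1_def lam1)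
  then have "p\<^sup>2 * w = p\<^sup>2 * (s p * p)"
    unfolding ppw by (simp add: power2_eq_square power3_eq_cube mult_ac)
  moreover have p: "p \<noteq> 0" using m mpw by auto
  ultimately have w: "w = s p * p"
    by simp
  have "g = ree_n e p"
  proof (rule extensionalityI[of _ V])
    show "g \<in> extensional V" using g(1) by (simp add: Bij_def)
    show "ree_n e p \<in> extensional V" by (simp add: ree_n_def)
    show "g x = ree_n e p x" if "x \<in> V" for x
      using that
    proof (cases rule: V_cases)
      case (2 a b c)
      then show ?thesis
        unfolding 2 img n_pt u v mpw w by (simp add: power2_eq_square)
    qed (simp add: g n_Infty)
  qed
  with p show thesis by (rule that)
qed

section \<open>Two-transitivity\<close>

sublocale R: permutation_group V R
  by (rule permutation_group_R)

text \<open>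
  A translation and then \<open>w\<close> take \<open>x\<close> to \<open>Infty\<close>; a
  translation, which fixes \<open>Infty\<close>, takes the image of \<open>y\<close> to the
  origin.
\<close>

lemma R_to_standard_pair:
  assumes "x \<in> V" "y \<in> V" "x \<noteq> y"
  obtains g where "g \<in> carrier R" "g x = Infty" "g y = pt 0 0 0"
proof -
  have t: "\<exists>g\<in>carrier R. g Infty = Infty \<and> g (pt a b c) = pt 0 0 0" for a b c
  proof -
    obtain h where h: "h \<in> carrier R" "\<forall>x\<in>V. h (ree_t e a b c x) = x"
      using R.inverse[OF R_generators(2)] by blast
    have "h (ree_t e a b c Infty) = Infty" "h (ree_t e a b c (pt 0 0 0)) = pt 0 0 0"
      using h(2) by simp_all
    then show ?thesis
      using h(1) by (auto simp: t_Infty t_pt)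
  qed
  have "\<exists>g\<in>carrier R. g x = Infty"
    using assms(1)
  proof (cases rule: V_cases)
    case 1
    then show ?thesis by (intro bexI[OF _ R.identity]) simp
  next
    case (2 a b c)
    obtain g where g: "g \<in> carrier R" "g (pt a b c) = pt 0 0 0"
      using t[of a b c] by blast
    show ?thesis
      by (rule bexI[OF _ R.compose[OF R_generators(1) g(1)]]) (simp add: 2 compose_eq g(2) w_origin)
  qed
  then obtain g where g: "g \<in> carrier R" "g x = Infty" by blast
  have "g y \<in> V" "g y \<noteq> Infty"
    using R.closed[OF g(1) assms(2)] R.eq_iff[OF g(1) assms(1,2)] assms(3) g(2) by auto
  then obtain a b c where abc: "g y = pt a b c"
    by (metis V_cases)
  obtain h where h: "h \<in> carrier R" "h Infty = Infty" "h (pt a b c) = pt 0 0 0"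
    using t by blast
  show thesis
    by (rule that[OF R.compose[OF h(1) g(1)]]) (simp_all add: compose_eq assms g h abc)
qed

lemma R_two_transitive:
  assumes "x \<in> V" "y \<in> V" "x \<noteq> y" "x' \<in> V" "y' \<in> V" "x' \<noteq> y'"
  shows "\<exists>g\<in>carrier R. g x = x' \<and> g y = y'"
proof -
  obtain g where g: "g \<in> carrier R" "g x = Infty" "g y = pt 0 0 0"
    by (rule R_to_standard_pair[OF assms(1-3)])
  obtain h where h: "h \<in> carrier R" "h x' = Infty" "h y' = pt 0 0 0"
    by (rule R_to_standard_pair[OF assms(4-6)])
  obtain h' where h': "h' \<in> carrier R" "\<forall>x\<in>V. h' (h x) = x"
    using R.inverse[OF h(1)] by blast
  have "h' Infty = x'" "h' (pt 0 0 0) = y'"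
    using h'(2) assms(4,5) h by force+
  then show ?thesis
    by (intro bexI[OF _ R.compose[OF h'(1) g(1)]]) (simp add: compose_eq assms g)
qed

end

section \<open>The imprimitive block and its stabilizer\<close>

locale ree_block = ree_field e q F for e q and F :: "'a::finite_field itself" +
  fixes f :: "'a \<Rightarrow> 'a" and G :: "('a ree_point \<Rightarrow> 'a ree_point) monoid"
    and P :: "'a ree_point set" and \<delta> :: 'a
  assumes f: "field_automorphism f"
    and G_def: "G = subgroup_generated (BijGroup V) (carrier R \<union> {field_perm e f})"
    and normal: "carrier R \<lhd> G"
    and imprimitive: "imprimitive_block (stab_group G (\<lambda>g. g) Infty) (V - {Infty}) P"
    and origin_in_P: "pt 0 0 0 \<in> P" and card_P: "card P = q\<^sup>2"
    and \<delta>: "generates_units \<delta>"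
    and orbits_in_P:
      "Group_Action.orbit (stab_group (stab_group R (\<lambda>g. g) Infty) (\<lambda>g. g) (pt 0 0 0)) (\<lambda>g. g) (pt 0 1 0) \<subseteq> P"
      "Group_Action.orbit (stab_group (stab_group R (\<lambda>g. g) Infty) (\<lambda>g. g) (pt 0 0 0)) (\<lambda>g. g) (pt 0 \<delta> 0) \<subseteq> P"
begin

abbreviation \<zeta> where "\<zeta> \<equiv> field_perm e f"

lemma f_hom: "f (x + y) = f x + f y" "f (x * y) = f x * f y" "f 1 = 1" "bij f"
  using f by (auto simp: field_automorphism_def)

lemma f_0: "f 0 = 0"
proof -
  have "f 0 + 0 = f 0 + f 0"
    using f_hom(1)[of 0 0] by (simp only: add_0_right)
  then show ?thesis
    by (simp only: add_left_cancel)
qed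

lemma f_minus: "f (- x) = - f x"
  using f_hom(1)[of x "- x"] by (simp add: f_0 eq_neg_iff_add_eq_0 add.commute)

lemma f_diff: "f (x - y) = f x - f y"
  using f_hom(1)[of x "- y"] by (simp add: f_minus)

lemma f_power: "f (x ^ n) = f x ^ n"
  by (induction n) (simp_all add: f_hom)

lemma \<zeta>_Infty: "\<zeta> Infty = Infty"
  by (simp add: field_perm_def)

lemma \<zeta>_pt: "\<zeta> (pt a b c) = pt (f a) (f b) (f c)"
proof -
  have "f (s x) = s (f x)" for x
    by (simp add: s_def f_power)
  then show ?thesis
    by (simp add: field_perm_def case_pt) 
      (simp add: ree_pt_def lam1 lam2 lam3 f_hom f_diff f_power)
qed

lemma \<zeta>_Bij: "\<zeta> \<in> Bij V"
proof (rule BijI)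
  show "\<zeta> \<in> extensional V" by (simp add: field_perm_def)
  show "\<zeta> x \<in> V" if "x \<in> V" for x
    using that by (cases rule: V_cases) (simp_all add: \<zeta>_pt \<zeta>_Infty)
  have "f x = f y \<longleftrightarrow> x = y" for x y
    using f_hom(4) by (auto simp: bij_def inj_def)
  then show "inj_on \<zeta> V"
    by (intro inj_onI) (auto simp: \<zeta>_pt \<zeta>_Infty elim!: V_cases)
qed

lemma G_subgroup: "subgroup (carrier G) (BijGroup V)"
  unfolding G_def by (rule group.subgroup_subgroup_generated[OF group_BijGroup])

sublocale G: permutation_group V G
  by (rule permutation_group.intro[OF G_subgroup])

lemma G_generators: "carrier R \<subseteq> carrier G" "\<zeta> \<in> carrier G"
proof -
  have "carrier R \<union> {\<zeta>} \<subseteq> carrier G"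
    unfolding G_def
    by (rule group.subgroup_generated_subset_carrier_subset[OF group_BijGroup])
      (use R.Bij \<zeta>_Bij in \<open>auto simp: BijGroup_def\<close>)
  then show "carrier R \<subseteq> carrier G" "\<zeta> \<in> carrier G" by simp_all
qed

lemma P_subset: "P \<subseteq> V - {Infty}"
  using imprimitive by (simp add: imprimitive_block_def)

lemma G_block:
  assumes "g \<in> carrier G" "g Infty = Infty"
  shows "g ` P = P \<or> g ` P \<inter> P = {}"
  using imprimitive assms by (simp add: imprimitive_block_def stab_group_def stabilizer_def)

lemma block_fixed:
  assumes "g \<in> carrier G" "g Infty = Infty" "x \<in> P" "g x \<in> P"
  shows "g ` P = P"
  using G_block[OF assms(1,2)] assms(3,4) by blast

lemma n_orbit:
  assumes "\<kappa> \<noteq> 0"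
  shows "pt 0 (s \<kappa> * \<kappa>) 0 \<in> P" "pt 0 (s \<kappa> * \<kappa> * \<delta>) 0 \<in> P"
proof -
  have "ree_n e \<kappa> \<in> carrier (stab_group (stab_group R (\<lambda>g. g) Infty) (\<lambda>g. g) (pt 0 0 0))"
    using R_generators(3)[OF assms] by (simp add: stab_group_def stabilizer_def n_Infty n_pt)
  then have "ree_n e \<kappa> (pt 0 1 0) \<in> P" "ree_n e \<kappa> (pt 0 \<delta> 0) \<in> P"
    using orbits_in_P unfolding Group_Action.orbit_def by blast+
  then show "pt 0 (s \<kappa> * \<kappa>) 0 \<in> P" "pt 0 (s \<kappa> * \<kappa> * \<delta>) 0 \<in> P"
    by (simp_all add: n_pt)
qed

text \<open>
  If \<open>\<kappa> = s y / y\<close> then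
  \<open>s \<kappa> * \<kappa> = s (s y) / y = y\<^sup>2\<close>, so one of the two given orbits
  supplies the nonzero squares as second coordinate and the other the elements
  \<open>\<delta> * y\<^sup>2\<close>, that is, the odd powers of \<open>\<delta>\<close>.
\<close>

lemma second_axis: "pt 0 b 0 \<in> P"
proof (cases "b = 0")
  case False
  have sq: "\<exists>\<kappa>. \<kappa> \<noteq> 0 \<and> s \<kappa> * \<kappa> = y * y" if "y \<noteq> 0" for y
    by (rule exI[of _ "s y / y"]) (use that in \<open>simp add: s_divide s_s power3_eq_cube\<close>)
  have "b \<in> range (\<lambda>k::int. \<delta> powi k)" "\<delta> \<noteq> 0"
    using \<delta> False by (auto simp: generates_units_def)
  then obtain k :: int where k: "b = \<delta> powi k" by blast
  define y where "y = \<delta> powi (k div 2)"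
  have y: "y \<noteq> 0" using \<open>\<delta> \<noteq> 0\<close> by (simp add: y_def)
  then obtain \<kappa> where \<kappa>: "\<kappa> \<noteq> 0" "s \<kappa> * \<kappa> = y * y" using sq by blast
  have "k = k div 2 + k div 2 + k mod 2" by presburger
  then have "b = y * y * \<delta> powi (k mod 2)"
    using \<open>\<delta> \<noteq> 0\<close> unfolding k y_def by (metis power_int_add)
  moreover have "k mod 2 = 0 \<or> k mod 2 = 1" by presburger
  ultimately show ?thesis
    using n_orbit[OF \<kappa>(1)] \<kappa>(2) by auto
qed (use origin_in_P in simp)

text \<open>
  Any \<open>ree_t\<close> that takes the origin to a point of \<open>P\<close> fixes
  \<open>P\<close>. So \<open>P\<close> is invariant under the maps
  \<open>ree_t e 0 \<beta> 0\<close>, and a point \<open>pt \<alpha> b c\<close> in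
  \<open>P\<close> gives one more invariance, which together with them moves the third coordinate
  by every multiple of \<open>\<alpha>\<close>.
\<close>

lemma P_eq: "P = {pt 0 b c | b c. True}"
proof -
  have t: "ree_t e \<alpha> \<beta> \<gamma> ` P = P" if "pt \<alpha> \<beta> \<gamma> \<in> P" for \<alpha> \<beta> \<gamma>
    by (rule block_fixed[OF subsetD[OF G_generators(1) R_generators(2)] t_Infty origin_in_P])
      (use that in \<open>simp add: t_pt\<close>)
  have shift: "pt a (b + \<beta>) (c + \<beta> * a) \<in> P" if "pt a b c \<in> P" for a b c \<beta>
  proof -
    have "ree_t e 0 \<beta> 0 (pt a b c) \<in> ree_t e 0 \<beta> 0 ` P"
      using that by (rule imageI)
    then show ?thesis
      unfolding t[OF second_axis] by (simp add: t_pt)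
  qed
  have zero: "\<alpha> = 0" if P: "pt \<alpha> b c \<in> P" for \<alpha> b c
  proof (rule ccontr)
    assume \<alpha>: "\<alpha> \<noteq> 0"
    have "pt \<alpha> b (c + \<alpha> * \<beta>) \<in> P" for \<beta>
    proof -
      have "ree_t e \<alpha> b c (pt 0 \<beta> 0) \<in> ree_t e \<alpha> b c ` P"
        using second_axis by (rule imageI)
      then have "pt \<alpha> (\<beta> + b) (c - \<alpha> * \<beta>) \<in> P"
        unfolding t[OF P] by (simp add: t_pt)
      from shift[OF this, of "- \<beta>"] have "pt \<alpha> b (c - \<alpha> * \<beta> - \<beta> * \<alpha>) \<in> P"
        by simp
      \<comment> \<open>In characteristic 3 subtracting twice is adding once.\<close>
      also have "c - \<alpha> * \<beta> - \<beta> * \<alpha> = c + \<alpha> * \<beta> - 3 * (\<alpha> * \<beta>)"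
        by (simp add: algebra_simps)
      finally show ?thesis
        by (simp add: three)
    qed
    note third = this
    have "pt \<alpha> b' c' \<in> P" for b' c'
    proof -
      have "pt \<alpha> b (c' - (b' - b) * \<alpha>) \<in> P"
        using third[of "(c' - (b' - b) * \<alpha> - c) / \<alpha>"] \<alpha> by simp
      from shift[OF this, of "b' - b"] show ?thesis by simp
    qed
    then have "(\<lambda>(b, c). pt \<alpha> b c) ` UNIV \<subseteq> P - {pt 0 0 0}"
      using \<alpha> by auto
    then have "card ((\<lambda>(b, c). pt \<alpha> b c) ` UNIV) \<le> card (P - {pt 0 0 0})"
      by (rule card_mono[rotated]) (use P_subset finite_V finite_subset in blast)
    moreover have "card ((\<lambda>(b, c). pt \<alpha> b c) ` UNIV) = CARD('a \<times> 'a)"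
      by (rule card_image) (auto simp: inj_on_def)
    ultimately have "CARD('a \<times> 'a) \<le> q\<^sup>2 - 1"
      using card_P origin_in_P by simp
    moreover have "CARD('a \<times> 'a) = q\<^sup>2"
      by (simp add: card_F power2_eq_square)
    moreover have "0 < q\<^sup>2"
      using q_ge_3 by simp
    ultimately show False
      by linarith
  qed
  show ?thesis
  proof (rule card_subset_eq)
    have eq: "{pt 0 b c | b c. True} = (\<lambda>(b, c). pt 0 b c) ` UNIV"
      by auto
    show "finite {pt 0 b c | b c. True}"
      unfolding eq by simp
    show "P \<subseteq> {pt 0 b c | b c. True}"
    proof
      fix x assume x: "x \<in> P"
      then have "x \<in> V" "x \<noteq> Infty" using P_subset by auto
      then obtain a b c where "x = pt a b c" by (metis V_cases)
      then show "x \<in> {pt 0 b c | b c. True}" using zero x by auto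
    qed
    have "card ((\<lambda>(b, c). pt 0 b c) ` UNIV) = CARD('a \<times> 'a)"
      by (rule card_image) (auto simp: inj_on_def)
    then show "card P = card {pt 0 b c | b c. True}"
      unfolding eq by (simp add: card_P card_F power2_eq_square)
  qed
qed

definition L where "L = insert Infty P"

lemma L_subset: "L \<subseteq> V"
  using P_subset by (auto simp: L_def)

lemma mem_P: "pt a b c \<in> P \<longleftrightarrow> a = 0"
  by (auto simp: P_eq)

lemma n_fixes_P: "\<kappa> \<noteq> 0 \<Longrightarrow> ree_n e \<kappa> ` P = P"
  by (rule block_fixed[OF subsetD[OF G_generators(1) R_generators(3)] n_Infty origin_in_P])
    (simp_all add: n_pt origin_in_P)

lemma t_fixes_P: "ree_t e 0 \<beta> \<gamma> ` P = P"
  by (rule block_fixed[OF subsetD[OF G_generators(1) R_generators(2)] t_Infty origin_in_P])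
    (simp_all add: t_pt mem_P)

lemma \<zeta>_fixes_P: "\<zeta> ` P = P"
  by (rule block_fixed[OF G_generators(2) \<zeta>_Infty origin_in_P])
    (simp_all add: \<zeta>_pt f_0 origin_in_P)

definition Z where "Z = generate (BijGroup V) {\<zeta>}"

lemma Z_subgroup: "subgroup Z (BijGroup V)"
  unfolding Z_def by (rule group.generate_is_subgroup[OF group_BijGroup]) (use \<zeta>_Bij in \<open>simp add: BijGroup_def\<close>)

sublocale Sym: permutation_group V "BijGroup V"
  by (rule permutation_group.intro[OF group.subgroup_self[OF group_BijGroup]])

lemma Z_fixes:
  assumes "z \<in> Z"
  shows "z \<in> Bij V" "z Infty = Infty" "z (pt 0 0 0) = pt 0 0 0" "z ` P = P"
proof -
  have "\<zeta> \<in> {g \<in> carrier (BijGroup V). g Infty = Infty \<and> g ` P = P}"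
    "\<zeta> \<in> {g \<in> carrier (BijGroup V). g (pt 0 0 0) = pt 0 0 0 \<and> g ` {} = {}}"
    using \<zeta>_Bij by (simp_all add: BijGroup_def \<zeta>_Infty \<zeta>_pt f_0 \<zeta>_fixes_P)
  then have "Z \<subseteq> {g \<in> carrier (BijGroup V). g Infty = Infty \<and> g ` P = P}"
    "Z \<subseteq> {g \<in> carrier (BijGroup V). g (pt 0 0 0) = pt 0 0 0 \<and> g ` {} = {}}"
    unfolding Z_def using P_subset
    by (intro group.generate_subgroup_incl[OF group_BijGroup] Sym.subgroup_stabilizer; auto)+
  then show "z \<in> Bij V" "z Infty = Infty" "z (pt 0 0 0) = pt 0 0 0" "z ` P = P"
    using assms by (auto simp: BijGroup_def)
qed

text \<open>
  As the Ree group is normal, its product with the group \<open>Z\<close> generated by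
  \<open>\<zeta>\<close> is a subgroup; it contains the generators of \<open>G\<close>.
\<close>

lemma G_factorization:
  assumes "g \<in> carrier G"
  obtains r z where "r \<in> carrier R" "z \<in> Z" "g = compose V r z"
proof -
  have G: "group G"
    unfolding G_def by (rule group.group_subgroup_generated[OF group_BijGroup])
  have mult: "r \<otimes>\<^bsub>G\<^esub> z = r \<otimes>\<^bsub>BijGroup V\<^esub> z" for r z
    by (simp add: G_def)
  have Z_G: "Z \<subseteq> carrier G"
    unfolding Z_def using G_generators(2)
    by (intro group.generate_subgroup_incl[OF group_BijGroup _ G_subgroup]) simp
  have "subgroup Z G"
    using group.subgroup_subgroup_generated_iff[OF group_BijGroup, of Z] Z_subgroup Z_G
    unfolding G_def by blast
  then have "subgroup (carrier R <#>\<^bsub>G\<^esub> Z) G"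
    by (rule group.mult_norm_subgroup[OF G normal])
  then have sub: "subgroup (carrier R <#>\<^bsub>G\<^esub> Z) (BijGroup V)"
    using group.subgroup_subgroup_generated_iff[OF group_BijGroup, of "carrier R <#>\<^bsub>G\<^esub> Z"]
    unfolding G_def by blast
  have eq: "r \<otimes>\<^bsub>G\<^esub> z = compose V r z" if "r \<in> carrier R" "z \<in> Z" for r z
    unfolding mult using R.Bij[OF that(1)] Z_fixes(1)[OF that(2)] by (simp add: BijGroup_def)
  have mem: "h \<in> carrier R <#>\<^bsub>G\<^esub> Z \<longleftrightarrow> (\<exists>r\<in>carrier R. \<exists>z\<in>Z. h = compose V r z)" for h
    unfolding set_mult_def using eq by auto
  have "carrier R \<union> {\<zeta>} \<subseteq> carrier R <#>\<^bsub>G\<^esub> Z"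
  proof
    fix h assume "h \<in> carrier R \<union> {\<zeta>}"
    then consider "h \<in> carrier R" | "h = \<zeta>" by blast
    then show "h \<in> carrier R <#>\<^bsub>G\<^esub> Z"
    proof cases
      case 1
      have "(\<lambda>x\<in>V. x) \<in> Z"
        using subgroup.one_closed[OF Z_subgroup] by (simp add: BijGroup_def)
      moreover have "h = compose V h (\<lambda>x\<in>V. x)"
        using compose_Id[OF Bij_imp_funcset Bij_imp_extensional] R.Bij[OF 1] by metis
      ultimately show ?thesis
        using 1 unfolding mem by blast
    next
      case 2
      have "\<zeta> \<in> Z"
        unfolding Z_def by (rule generate.incl) simp
      moreover have "h = compose V (\<lambda>x\<in>V. x) h"
        using Id_compose[OF Bij_imp_funcset Bij_imp_extensional] \<zeta>_Bij 2 by metis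
      ultimately show ?thesis
        using R.identity 2 unfolding mem by blast
    qed
  qed
  then have "carrier G \<subseteq> carrier R <#>\<^bsub>G\<^esub> Z"
    unfolding G_def[of] by (intro group.subgroup_generated_minimal[OF group_BijGroup]) (use sub in \<open>simp_all add: G_def\<close>)
  then have "g \<in> carrier R <#>\<^bsub>G\<^esub> Z"
    using assms by (rule subsetD)
  then obtain r z where "r \<in> carrier R" "z \<in> Z" "g = compose V r z"
    unfolding mem by blast
  then show thesis
    by (rule that)
qed

lemma generators_Bij:
  "{ree_n e \<kappa> | \<kappa>. \<kappa> \<noteq> 0} \<union> {ree_t e 0 \<xi> \<eta> | \<xi> \<eta>. True} \<union> {\<zeta>} \<subseteq> carrier (BijGroup V)"
  using n_Bij t_Bij \<zeta>_Bij by (auto simp: BijGroup_def)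

text \<open>
  The maps \<open>ree_t e 0 \<xi> \<eta>\<close> are transitive on \<open>P\<close>, so an element
  of the stabilizer is one of them times an element \<open>r z\<close> that fixes
  \<open>Infty\<close> and the origin. Since \<open>z\<close> fixes both points, so does
  \<open>r\<close>, and \<open>stabilizer_two_points\<close> applies to \<open>r\<close>.
\<close>

lemma block_stabilizer:
  "stab_group (stab_group G (\<lambda>g. g) Infty) image P = subgroup_generated (BijGroup V)
    ({ree_n e \<kappa> | \<kappa>. \<kappa> \<noteq> 0} \<union> {ree_t e 0 \<xi> \<eta> | \<xi> \<eta>. True} \<union> {\<zeta>})" (is "_ = subgroup_generated _ ?S")
proof -
  define K where "K = {g \<in> carrier G. g Infty = Infty \<and> g ` P = P}"
  have "K = generate (BijGroup V) ?S"
  proof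
    show "generate (BijGroup V) ?S \<subseteq> K"
    proof (rule group.generate_subgroup_incl[OF group_BijGroup])
      show "?S \<subseteq> K"
        unfolding K_def using G_generators R_generators(2,3) n_Infty t_Infty \<zeta>_Infty n_fixes_P t_fixes_P \<zeta>_fixes_P
        by blast
      show "subgroup K (BijGroup V)"
        unfolding K_def using P_subset by (intro G.subgroup_stabilizer) auto
    qed
    show "K \<subseteq> generate (BijGroup V) ?S"
    proof
      fix g assume "g \<in> K"
      then have g: "g \<in> carrier G" "g Infty = Infty" "g ` P = P"
        by (simp_all add: K_def)
      have "g (pt 0 0 0) \<in> P"
        using g(3) origin_in_P by blast
      then obtain \<xi> \<eta> where img: "g (pt 0 0 0) = pt 0 \<xi> \<eta>"
        unfolding P_eq by blast
      define t where "t = ree_t e 0 \<xi> \<eta>"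
      have t: "t \<in> carrier R" "t (pt 0 0 0) = pt 0 \<xi> \<eta>" "t Infty = Infty"
        using R_generators(2) by (simp_all add: t_def t_pt t_Infty)
      obtain t' where t': "t' \<in> carrier R" "\<forall>x\<in>V. t' (t x) = x" "\<forall>x\<in>V. t (t' x) = x"
        using R.inverse[OF t(1)] by blast
      have t'_fix: "t' (pt 0 \<xi> \<eta>) = pt 0 0 0" "t' Infty = Infty"
        using bspec[OF t'(2), of "pt 0 0 0"] bspec[OF t'(2), of Infty] t(2,3) by simp_all
      have "compose V t' g \<in> carrier G"
        using G.compose[OF subsetD[OF G_generators(1) t'(1)] g(1)] .
      then obtain r z where rz: "r \<in> carrier R" "z \<in> Z" "compose V t' g = compose V r z"
        by (rule G_factorization)
      have eq: "t' (g x) = r (z x)" if "x \<in> V" for x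
        using fun_cong[OF rz(3), of x] that by (simp add: compose_eq)
      note z = Z_fixes[OF rz(2)]
      have "r Infty = Infty" "r (pt 0 0 0) = pt 0 0 0"
        using eq[of Infty] eq[of "pt 0 0 0"] z(2,3) g(2) img t'_fix by simp_all
      then obtain \<kappa> where \<kappa>: "\<kappa> \<noteq> 0" "r = ree_n e \<kappa>"
        using stabilizer_two_points[OF R_similitude[OF rz(1)]] by blast
      have "g = compose V t (compose V r z)"
      proof (rule extensionalityI[of _ V])
        show "g \<in> extensional V" using G.Bij[OF g(1)] by (simp add: Bij_def)
        show "g x = compose V t (compose V r z) x" if "x \<in> V" for x
          using t'(3) G.closed[OF g(1) that] eq[OF that] that by (simp add: compose_eq) (metis)
      qed simp
      also have "\<dots> = t \<otimes>\<^bsub>BijGroup V\<^esub> (r \<otimes>\<^bsub>BijGroup V\<^esub> z)"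
        using R.Bij[OF t(1)] R.Bij[OF rz(1)] z(1) by (simp add: BijGroup_def compose_Bij)
      also have "\<dots> \<in> generate (BijGroup V) ?S"
      proof (intro generate.eng)
        show "t \<in> generate (BijGroup V) ?S" unfolding t_def by (rule generate.incl) blast
        show "r \<in> generate (BijGroup V) ?S" using \<kappa> by (intro generate.incl) blast
        show "z \<in> generate (BijGroup V) ?S"
          using rz(2) group.mono_generate[OF group_BijGroup, of "{\<zeta>}" ?S] unfolding Z_def by blast
      qed
      finally show "g \<in> generate (BijGroup V) ?S" .
    qed
  qed
  moreover have "carrier (BijGroup V) \<inter> ?S = ?S"
    using generators_Bij by blast
  ultimately show ?thesis
    unfolding stab_group_def stabilizer_def subgroup_generated_def
    by (simp add: K_def G_def subgroup_generated_def)
qed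

text \<open>
  In a factorization \<open>r z\<close> the factor \<open>z\<close> fixes the flag
  \<open>(Infty, L)\<close>.
\<close>

lemma orbits_eq:
  "Group_Action.orbit G image L = Group_Action.orbit R image L"
  "Group_Action.orbit G flag_act (Infty, L) = Group_Action.orbit R flag_act (Infty, L)"
proof -
  have ex: "\<exists>r\<in>carrier R. g Infty = r Infty \<and> g ` L = r ` L" if "g \<in> carrier G" for g
  proof -
    obtain r z where rz: "r \<in> carrier R" "z \<in> Z" "g = compose V r z"
      using \<open>g \<in> carrier G\<close> by (rule G_factorization)
    have "z ` L = L"
      using Z_fixes(2,4)[OF rz(2)] by (simp add: L_def)
    then have "g ` L = r ` L"
      unfolding rz(3) R.compose_image[OF L_subset] by simp
    moreover have "g Infty = r Infty"
      unfolding rz(3) using Z_fixes(2)[OF rz(2)] by (simp add: compose_eq)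
    ultimately show ?thesis using rz(1) by blast
  qed
  show "Group_Action.orbit G image L = Group_Action.orbit R image L"
  proof
    show "Group_Action.orbit R image L \<subseteq> Group_Action.orbit G image L"
      using G_generators(1) by (auto simp: Group_Action.orbit_def)
    show "Group_Action.orbit G image L \<subseteq> Group_Action.orbit R image L"
    proof
      fix A assume "A \<in> Group_Action.orbit G image L"
      then obtain g where g: "g \<in> carrier G" "A = g ` L"
        by (auto simp: Group_Action.orbit_def)
      show "A \<in> Group_Action.orbit R image L"
        using ex[OF g(1)] g(2) by (auto simp: Group_Action.orbit_def)
    qed
  qed
  show "Group_Action.orbit G flag_act (Infty, L) = Group_Action.orbit R flag_act (Infty, L)"
  proof
    show "Group_Action.orbit R flag_act (Infty, L) \<subseteq> Group_Action.orbit G flag_act (Infty, L)"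
      using G_generators(1) by (auto simp: Group_Action.orbit_def)
    show "Group_Action.orbit G flag_act (Infty, L) \<subseteq> Group_Action.orbit R flag_act (Infty, L)"
    proof
      fix A assume "A \<in> Group_Action.orbit G flag_act (Infty, L)"
      then obtain g where g: "g \<in> carrier G" "A = flag_act g (Infty, L)"
        by (auto simp: Group_Action.orbit_def)
      show "A \<in> Group_Action.orbit R flag_act (Infty, L)"
        using ex[OF g(1)] g(2) by (auto simp: Group_Action.orbit_def flag_act_def)
    qed
  qed
qed

definition B where "B = Group_Action.orbit R image L"
definition \<Omega> where "\<Omega> = Group_Action.orbit R flag_act (Infty, L)"

sublocale R: flag_setting V R Infty P L q B \<Omega>
proof unfold_locales
  show "finite V" "card V = q ^ 3 + 1" "card P = q\<^sup>2"
    by (rule finite_V card_V card_P)+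
  show "2 \<le> q" using q_ge_3 by simp
  show "g ` P = P \<or> g ` P \<inter> P = {}" if "g \<in> carrier R" "g Infty = Infty" for g
    using G_block subsetD[OF G_generators(1) that(1)] that(2) by blast
  show "\<exists>g\<in>carrier R. g x = x' \<and> g y = y'"
    if "x \<in> V" "y \<in> V" "x \<noteq> y" "x' \<in> V" "y' \<in> V" "x' \<noteq> y'" for x y x' y'
    by (rule R_two_transitive[OF that])
  show "Infty \<in> V" by (rule Infty_in_V)
qed (rule P_subset L_def B_def \<Omega>_def)+

sublocale G: flag_setting V G Infty P L q B \<Omega>
proof unfold_locales
  show "finite V" "card V = q ^ 3 + 1" "card P = q\<^sup>2"
    by (rule finite_V card_V card_P)+
  show "2 \<le> q" using q_ge_3 by simp
  show "g ` P = P \<or> g ` P \<inter> P = {}" if "g \<in> carrier G" "g Infty = Infty" for g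
    using G_block that by blast
  show "\<exists>g\<in>carrier G. g x = x' \<and> g y = y'"
    if "x \<in> V" "y \<in> V" "x \<noteq> y" "x' \<in> V" "y' \<in> V" "x' \<noteq> y'" for x y x' y'
    using R_two_transitive[OF that] G_generators(1) by blast
  show "Infty \<in> V" by (rule Infty_in_V)
  show "B = Group_Action.orbit G image L" "\<Omega> = Group_Action.orbit G flag_act (Infty, L)"
    by (simp_all only: B_def \<Omega>_def orbits_eq)
qed (rule P_subset L_def)+

text \<open>
  For \<open>y = pt 0 1 1\<close> the flag at \<open>y\<close> adjacent to
  \<open>(Infty, L)\<close> has the block \<open>t (w L)\<close>, where \<open>t\<close> is the
  translation from the origin to \<open>y\<close>. It does not contain the origin, because the
  preimage of the origin under \<open>t\<close> is \<open>pt 0 (-1) (-1)\<close>, where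
  \<open>\<lambda>\<^sub>2 \<noteq> 0\<close>, and so \<open>w\<close> does not map it into
  \<open>L\<close>. But \<open>\<lambda>\<^sub>2 = 0\<close> at \<open>y\<close>, hence
  \<open>y\<close> lies on the block \<open>w L\<close> of the flag at the origin adjacent to
  \<open>(Infty, L)\<close>, and this flag is adjacent to a second flag at \<open>y\<close>.
\<close>

lemma connected_graph: "connected (with_proj (flag_graph \<Omega> (flag_pairs \<Omega>)))"
proof -
  define w :: "'a ree_point \<Rightarrow> 'a ree_point" where "w = ree_w e"
  define y where "y = pt 0 1 1"
  have w: "w \<in> carrier R" "w Infty = pt 0 0 0" "w (pt 0 0 0) = Infty"
    using R_generators(1) by (simp_all add: w_def w_Infty w_origin)
  have f0: "(pt 0 0 0, w ` L) \<in> \<Omega>"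
    using R.flagI[OF w(1)] w(2) by simp
  have "Infty \<in> w ` L"
    using w(3) origin_in_P by (force simp: L_def)
  moreover have 0: "pt 0 0 0 \<in> L"
    using origin_in_P by (simp add: L_def)
  ultimately have arc1: "((Infty, L), (pt 0 0 0, w ` L)) \<in> flag_pairs \<Omega>"
    using R.base_flag f0 by (simp add: R.mem_flag_pairs)
  have "w y \<in> L"
    unfolding w_def y_def by (subst w_pt(1)) (simp_all add: L_def mem_P lam2)
  moreover have "y = w (w y)"
    using w_w(2)[of y] by (simp add: w_def y_def)
  ultimately have y: "y \<in> w ` L" by blast
  obtain N where N: "(y, N) \<in> \<Omega>" "pt 0 0 0 \<in> N"
    by (rule R.flag_through[of y "pt 0 0 0"]) (simp_all add: y_def)
  have arc2: "((y, N), (pt 0 0 0, w ` L)) \<in> flag_pairs \<Omega>"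
    using f0 N y by (simp add: R.mem_flag_pairs y_def)
  define t :: "'a ree_point \<Rightarrow> 'a ree_point" where "t = ree_t e 0 1 1"
  have t: "t \<in> carrier R" "t Infty = Infty" "t (pt 0 0 0) = y"
    using R_generators(2) by (simp_all add: t_def t_Infty t_pt y_def)
  have f1: "(y, t ` w ` L) \<in> \<Omega>"
    using R.flag_act[OF t(1) f0] t(3) by simp
  moreover have "Infty \<in> t ` w ` L"
    using \<open>Infty \<in> w ` L\<close> t(2) by force
  moreover have "y \<in> L"
    by (simp add: y_def L_def mem_P)
  ultimately have arc3: "((Infty, L), (y, t ` w ` L)) \<in> flag_pairs \<Omega>"
    using R.base_flag by (simp add: R.mem_flag_pairs y_def)
  have "pt 0 0 0 \<notin> t ` w ` L"
  proof
    assume "pt 0 0 0 \<in> t ` w ` L"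
    then obtain l where l: "l \<in> L" "t (w l) = pt 0 0 0" by auto
    have "t (w l) = t (pt 0 (-1) (-1))"
      by (simp add: l(2)) (simp add: t_def t_pt)
    moreover have lV: "l \<in> V" using l(1) L_subset by blast
    ultimately have "w l = pt 0 (-1) (-1)"
      using R.eq_iff[OF t(1) R.closed[OF w(1) lV]] by simp
    then have "l = w (pt 0 (-1) (-1))"
      using w_w(2)[OF lV] by (simp add: w_def)
    moreover have "lam2 e 0 (-1) (-1) \<noteq> (0::'a)" "lam3 e 0 (-1) (-1) \<noteq> (0::'a)"
      by (simp_all add: lam2 lam3_eq_0_iff s_minus residues_mod_3[OF three])
    ultimately show False
      using l(1) unfolding w_def by (subst (asm) w_pt(1)) (simp_all add: L_def mem_P)
  qed
  then have "N \<noteq> t ` w ` L" using N(2) by blast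
  moreover have "((y, N), (y, t ` w ` L)) \<in> (flag_pairs \<Omega>)\<^sup>*"
    using arc2 R.flag_pairs_sym[OF arc1] arc3 by (meson rtrancl.rtrancl_refl rtrancl.rtrancl_into_rtrancl)
  ultimately show ?thesis
  proof (rule R.connected_flag_graph[OF N(1) f1])
    fix M N assume MN: "(Infty, M) \<in> \<Omega>" "(Infty, N) \<in> \<Omega>" "M \<noteq> L" "N \<noteq> L"
    have ex: "\<exists>a b c. pt a b c \<in> M \<and> a \<noteq> 0" if M: "(Infty, M) \<in> \<Omega>" "M \<noteq> L" for M
    proof -
      have "M \<noteq> {Infty}"
        using R.flag_props(4)[OF M(1)] q_ge_3 by auto
      then obtain x where x: "x \<in> M" "x \<noteq> Infty"
        using R.flag_props(2)[OF M(1)] by blast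
      then have "x \<notin> L"
        using R.flags_disjoint[OF M(1) R.base_flag] M(2) by blast
      moreover have "x \<in> V"
        using x R.flag_props(3)[OF M(1)] by blast
      then obtain a b c where "x = pt a b c"
        using x(2) by (metis V_cases)
      ultimately show ?thesis
        using x(1) by (auto simp: L_def mem_P)
    qed
    obtain a b c where abc: "pt a b c \<in> M" "a \<noteq> 0" using ex MN by blast
    obtain a' b' c' where abc': "pt a' b' c' \<in> N" "a' \<noteq> 0" using ex MN by blast
    \<comment> \<open>The stabilizer of \<open>(Infty, L)\<close> is transitive on the points outside \<open>L\<close>: \<open>ree_n e \<kappa>\<close>
      adjusts the first coordinate, \<open>ree_t e 0 \<beta> \<gamma>\<close> the other two.\<close>
    define \<kappa> where "\<kappa> = a' / a"
    have \<kappa>: "\<kappa> \<noteq> 0" "\<kappa> * a = a'" using abc abc' by (simp_all add: \<kappa>_def)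
    define \<beta> where "\<beta> = b' - s \<kappa> * \<kappa> * b"
    define \<gamma> where "\<gamma> = c' - s \<kappa> * \<kappa>\<^sup>2 * c - \<beta> * a'"
    define g where "g = compose V (ree_t e 0 \<beta> \<gamma>) (ree_n e \<kappa>)"
    have g: "g \<in> carrier R"
      unfolding g_def by (rule R.compose[OF R_generators(2) R_generators(3)[OF \<kappa>(1)]])
    have gz: "g Infty = Infty"
      by (simp add: g_def compose_eq n_Infty t_Infty)
    have gL: "g ` L = L"
    proof -
      have "g ` L = ree_t e 0 \<beta> \<gamma> ` ree_n e \<kappa> ` L"
        unfolding g_def by (rule R.compose_image[OF L_subset])
      also have "\<dots> = L"
        unfolding L_def by (simp add: n_fixes_P[OF \<kappa>(1)] t_fixes_P n_Infty t_Infty)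
      finally show ?thesis .
    qed
    have "g (pt a b c) = pt a' b' c'"
      by (simp add: g_def compose_eq n_pt t_pt \<kappa>(2) \<beta>_def \<gamma>_def)
    then have "pt a' b' c' \<in> g ` M"
      using abc(1) by force
    then have "g ` M = N"
      using R.flags_disjoint[of Infty "g ` M" N] R.flag_act[OF g MN(1)] gz MN(2) abc'(1) by auto
    then show "\<exists>g\<in>carrier R. g Infty = Infty \<and> g ` L = L \<and> g ` M = N"
      using g gz gL by blast
  qed
qed

end

theorem lemma3p8:
  fixes e q :: nat
    and f :: "'a::finite_field \<Rightarrow> 'a" and \<delta> :: 'a
    and V P L\<^sub>1 L\<^sub>2 L :: "'a ree_point set"
    and \<zeta> :: "'a ree_point \<Rightarrow> 'a ree_point"
    and R G :: "('a ree_point \<Rightarrow> 'a ree_point) monoid"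
    and D :: "'a ree_point incidence_structure"
    and \<Omega> :: "'a ree_point flag set"
    and \<Xi> :: "('a ree_point flag \<times> 'a ree_point flag) set"
    and \<Gamma> :: "'a ree_point flag pair_pre_digraph"
  assumes q: "q = 3 ^ (2 * e + 1)" "CARD('a) = q"
    and V: "V = ree_points e"
    and R: "R = ree_group e"
    and \<zeta>: "field_automorphism f" "\<zeta> = field_perm e f"
    and G: "G = subgroup_generated (BijGroup V) (carrier R \<union> {\<zeta>})"
      "carrier R \<lhd> G"
    and P: "imprimitive_block (stab_group G (\<lambda>g. g) Infty) (V - {Infty}) P"
      "origin \<in> P" "card P = q^2"
    and \<delta>: "generates_units \<delta>"
    and L12:
      "L\<^sub>1 = Group_Action.orbit (stab_group (stab_group R (\<lambda>g. g) Infty) (\<lambda>g. g) origin) (\<lambda>g. g)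
               (ree_pt e 0 1 0)"
      "L\<^sub>2 = Group_Action.orbit (stab_group (stab_group R (\<lambda>g. g) Infty) (\<lambda>g. g) origin) (\<lambda>g. g)
               (ree_pt e 0 \<delta> 0)"
      "L\<^sub>1 \<union> L\<^sub>2 \<subseteq> P"
    and L: "L = insert Infty P"
    and D: "D = (V, Group_Action.orbit R image L)"
    and \<Omega>: "\<Omega> = Group_Action.orbit R flag_act (Infty, L)"
    and \<Xi>: "\<Xi> = flag_pairs \<Omega>"
    and \<Gamma>: "\<Gamma> = flag_graph \<Omega> \<Xi>"
  shows
    "(P = {ree_pt e 0 \<eta>\<^sub>2 \<eta>\<^sub>3 | \<eta>\<^sub>2 \<eta>\<^sub>3. True} \<and>
      stab_group (stab_group G (\<lambda>g. g) Infty) image P =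
        subgroup_generated (BijGroup V)
          ({ree_n e \<kappa> | \<kappa>. \<kappa> \<noteq> 0} \<union> {ree_t e 0 \<xi> \<eta> | \<xi> \<eta>. True} \<union> {\<zeta>})) \<and>
     (D = (V, Group_Action.orbit G image L) \<and>
      is_design 2 (q^3 + 1) (q^2 + 1) (q^2 + 1) D \<and>
      automorphism_group G D \<and>
      two_transitive_on G V \<and>
      transitive_on G image (snd D) \<and>
      \<Omega> = Group_Action.orbit G flag_act (Infty, L) \<and>
      one_feasible G D \<Omega> \<and>
      is_flag_graph G D \<Omega> \<Xi> \<Gamma> \<and>
      is_flag_graph R D \<Omega> \<Xi> \<Gamma>) \<and>
     (connected (with_proj \<Gamma>) \<and>
      card \<Omega> = q * (q^3 + 1) \<and>
      (\<forall>F\<in>\<Omega>. out_degree (with_proj \<Gamma>) F = q^2))"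
proof -
  interpret K: ree_field e q "TYPE('a)"
    using q by unfold_locales
  interpret X: ree_block e q "TYPE('a)" f G P \<delta>
  proof (rule ree_block.intro[OF K.ree_field_axioms], rule ree_block_axioms.intro)
    show "field_automorphism f" by (rule \<zeta>(1))
    show "G = subgroup_generated (BijGroup (ree_points e)) (carrier (ree_group e) \<union> {field_perm e f})"
      using G(1) V R \<zeta>(2) by simp
    show "carrier (ree_group e) \<lhd> G"
      using G(2) R by simp
    show "imprimitive_block (stab_group G (\<lambda>g. g) Infty) (ree_points e - {Infty}) P"
      using P(1) V by simp
    show "ree_pt e 0 0 0 \<in> P" "card P = q\<^sup>2"
      using P(2,3) by (simp_all add: K.origin_eq)
    show "generates_units \<delta>" by (rule \<delta>)
    show "Group_Action.orbit (stab_group (stab_group (ree_group e) (\<lambda>g. g) Infty) (\<lambda>g. g) (ree_pt e 0 0 0))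
        (\<lambda>g. g) (ree_pt e 0 1 0) \<subseteq> P"
      "Group_Action.orbit (stab_group (stab_group (ree_group e) (\<lambda>g. g) Infty) (\<lambda>g. g) (ree_pt e 0 0 0))
        (\<lambda>g. g) (ree_pt e 0 \<delta> 0) \<subseteq> P"
      using L12 R by (simp_all add: K.origin_eq)
  qed
  have L': "L = X.L" by (simp add: L X.L_def)
  have D': "D = (ree_points e, X.B)" by (simp add: D V R L' X.B_def)
  have \<Omega>': "\<Omega> = X.\<Omega>" by (simp add: \<Omega> R L' X.\<Omega>_def)
  have flag_graph: "is_flag_graph G D \<Omega> \<Xi> \<Gamma>" "is_flag_graph R D \<Omega> \<Xi> \<Gamma>"
    using X.G.one_feasible X.G.self_paired_orbit X.R.one_feasible X.R.self_paired_orbit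
    by (simp_all add: is_flag_graph_def D' \<Omega>' \<Xi> \<Gamma> R)
  show ?thesis
  proof (intro conjI)
    show "P = {ree_pt e 0 \<eta>\<^sub>2 \<eta>\<^sub>3 | \<eta>\<^sub>2 \<eta>\<^sub>3. True}"
      by (rule X.P_eq)
    show "stab_group (stab_group G (\<lambda>g. g) Infty) image P = subgroup_generated (BijGroup V)
        ({ree_n e \<kappa> | \<kappa>. \<kappa> \<noteq> 0} \<union> {ree_t e 0 \<xi> \<eta> | \<xi> \<eta>. True} \<union> {\<zeta>})"
      unfolding V \<zeta>(2) by (rule X.block_stabilizer)
    show "D = (V, Group_Action.orbit G image L)"
      by (simp add: D' V L' X.orbits_eq(1) X.B_def)
    show "is_design 2 (q ^ 3 + 1) (q\<^sup>2 + 1) (q\<^sup>2 + 1) D"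
      unfolding D' by (rule X.G.is_design)
    show "automorphism_group G D"
      unfolding D' by (rule X.G.automorphism_group)
    show "two_transitive_on G V"
      unfolding V by (rule X.G.two_transitive_on)
    show "transitive_on G image (snd D)"
      unfolding D' snd_conv by (rule X.G.transitive_on_blocks)
    show "\<Omega> = Group_Action.orbit G flag_act (Infty, L)"
      unfolding \<Omega>' L' X.orbits_eq(2) by (rule X.\<Omega>_def)
    show "one_feasible G D \<Omega>"
      unfolding D' \<Omega>' by (rule X.G.one_feasible)
    show "connected (with_proj \<Gamma>)"
      unfolding \<Gamma> \<Xi> \<Omega>' by (rule X.connected_graph)
    show "card \<Omega> = q * (q ^ 3 + 1)"
      unfolding \<Omega>' by (rule X.R.card_Omega)
    show "\<forall>F\<in>\<Omega>. out_degree (with_proj \<Gamma>) F = q\<^sup>2"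
      unfolding \<Gamma> \<Xi> \<Omega>' using X.R.out_degree by (rule ballI)
  qed (rule flag_graph)+
qed

end
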